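(* Let $\gamma$ be a positive integer. Consider the ARX system described in the context and suppose that Assumption A (with this $\gamma$), Assumption B and Assumption C of the context hold. Let $\hat\theta_k$ be the recursive least-squares (RLS) estimates and $\tilde\theta_k=\hat\theta_k-\theta$ the estimation errors. Then $\hat\theta_k$ converges to $\theta$ in the $L^{\gamma/2}$ sense with rate $O(1/k^{\gamma/4})$, i.e. $$\mathbb{E}\left[\Vert\tilde\theta_k\Vert_2^{\gamma/2}\right]=O\left(\frac{1}{k^{\gamma/4}}\right)\quad\text{as }k\to\infty .$$
   Context: **System.** Let $m,n$ be the orders of the system. The ARX system is $$y_k+a_1y_{k-1}+\cdots+a_my_{k-m}=b_1u_{k-1}+\cdots+b_nu_{k-n}+d_k,\qquad k\ge1,$$ i.e. $A(z)y_k=B(z)u_k+d_k$ with $z$ the unit backward shift ($zy_k=y_{k-1}$), $A(z)=1+a_1z+\cdots+a_mz^m$, $B(z)=b_1z+\cdots+b_nz^n$. Here $u_k\in\mathbb{R}$ is the input, $y_k\in\mathbb{R}$ the output, $d_k\in\mathbb{R}$ the unmeasurable noise, and $y_k=0$ for $k\le0$, $u_k=0$ for $k<0$. The unknown parameter is $\theta=[a_1,\dots,a_m,b_1,\dots,b_n]^T\in\mathbb{R}^{m+n}$ and the regression vector is $\phi_k=[-y_{k-1},\dots,-y_{k-m},u_{k-1},\dots,u_{k-n}]^T$, $k\ge1$. **RLS algorithm.** Given a (deterministic) initial value $\hat\theta_0\in\mathbb{R}^{m+n}$ and a symmetric positive definite matrix $P_0\in\mathbb{R}^{(m+n)\times(m+n)}$,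 for $k\ge1$: $$\hat\theta_k=\hat\theta_{k-1}+\alpha_kP_{k-1}\phi_k(y_k-\phi_k^T\hat\theta_{k-1}),\quad \alpha_k=(1+\phi_k^TP_{k-1}\phi_k)^{-1},\quad P_k=P_{k-1}-\alpha_kP_{k-1}\phi_k\phi_k^TP_{k-1}.$$ **Averaged expectation.** For a process $\{t_k\}$, $\bar{\mathbb{E}}[t_k]=\lim_{k\to\infty}\frac1k\sum_{l=1}^k\mathbb{E}[t_l]$ (entrywise for matrices). **Quasi-stationarity.** A real process $\{t_k\}$ is quasi-stationary if for some constant $C>0$, $\sup_k|\mathbb{E}[t_k]|<C$, $\sup_{i,j}|\mathbb{E}[t_it_j]|<C$, and $R^t_\tau=\bar{\mathbb{E}}[t_kt_{k-\tau}]$ exists for every $\tau\in\mathbb{Z}$. **Assumption A (with parameter $\gamma$).** There are a bounded deterministic sequence $\{r_k\}_{k\ge0}$ and a sequence $\{e_k\}_{k\ge0}$ of independent random variables with zero mean, variance $\delta_e^2$ and $\sup_k\mathbb{E}[|e_k|^{4\gamma}]<\infty$ (with $r_k=e_k=0$ for $k<0$), and deterministic real filters $f_i^{(j)}(k)$, $j=1,2,3,4$, such that $$y_k=\sum_{i=1}^\infty f_i^{(1)}(k)r_{k-i}+\sum_{i=0}^\infty f_i^{(2)}(k)e_{k-i}\ (k\ge1),\qquad u_k=\sum_{i=0}^\infty f_i^{(3)}(k)r_{k-i}+\sum_{i=0}^\infty f_i^{(4)}(k)e_{k-i}\ (k\ge0),$$ and: (i) (uniform stability) there is a sequence $\{f_i\}_{i\ge0}$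 with $\sup_{k,j}|f_i^{(j)}(k)|\le|f_i|$ for all $i$ and $\sum_i|f_i|<\infty$; (ii) (joint quasi-stationarity) $\{y_k\}_{k\ge1}$ and $\{u_k\}_{k\ge0}$ are quasi-stationary, and $R^{yu}_\tau=\bar{\mathbb{E}}[y_ku_{k-\tau}]$ exists for every $\tau\in\mathbb{Z}$; (iii) (persistent excitation) the matrix $\bar{\mathbb{E}}[\phi_k\phi_k^T]$ (whose entries are, up to sign, values of the covariance functions $R^y,R^u$ and the cross-covariance function of $y$ and $u$) is positive definite. **Assumption B.** $A$ is stable: the filter $1/A$ has no poles on or outside the unit circle in the forward-shift variable $q=z^{-1}$; equivalently $A(z)\ne0$ for all complex $z$ with $|z|\le1$. **Assumption C.** $\{d_k\}_{k\ge1}$ is a sequence of independent Gaussian random variables with zero mean and variance $\delta_d^2$. $\Vert\cdot\Vert_2$ is the Euclidean norm of a vector.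
   Formalization: The formal theorem additionally assumes E[φ_k d_k]=0 for k≥1; without it the claim fails, e.g. m=n=1, r=0, u_k=e_k iid N(0,1), d_k=e_{k-1}, b_1=1, |a_1|<1, where the estimates converge to (a_1,2) instead of (a_1,1). *)

theory Defs
  imports "HOL-Probability.Probability" "HOL-Library.Landau_Symbols"
begin

text \<open>
  All signals are indexed by \<open>int\<close>, so that the delays \<open>k - i\<close> are not truncated.
  Vectors in \<open>\<real>\<^sup>m\<^sup>+\<^sup>n\<close> have type \<open>real ^ 'd\<close>, where the
  coordinates are numbered by a bijection \<open>idx\<close> from \<open>'d\<close> onto \<open>{1..m+n}\<close>
  (so \<open>CARD('d) = m + n\<close>); the sequences \<open>a\<close>, \<open>b\<close> of coefficients
  are only ever used at indices \<open>1..m\<close> and \<open>1..n\<close>.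
\<close>

definition positive_definite :: "real ^ 'd ^ 'd \<Rightarrow> bool" where
  "positive_definite P \<longleftrightarrow> transpose P = P \<and> (\<forall>x. x \<noteq> 0 \<longrightarrow> x \<bullet> (P *v x) > 0)"

definition outer_product :: "real ^ 'd \<Rightarrow> real ^ 'd \<Rightarrow> real ^ 'd ^ 'd" where
  "outer_product v w = (\<chi> i j. v $ i * w $ j)"

definition arx_parameter ::
    "nat \<Rightarrow> (nat \<Rightarrow> real) \<Rightarrow> (nat \<Rightarrow> real) \<Rightarrow> ('d \<Rightarrow> nat) \<Rightarrow> real ^ 'd" where
  "arx_parameter m a b idx = (\<chi> c. if idx c \<le> m then a (idx c) else b (idx c - m))"

definition regressor ::
    "nat \<Rightarrow> ('d \<Rightarrow> nat) \<Rightarrow> (int \<Rightarrow> 'a \<Rightarrow> real) \<Rightarrow> (int \<Rightarrow> 'a \<Rightarrow> real) \<Rightarrow>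
      int \<Rightarrow> 'a \<Rightarrow> real ^ 'd" where
  "regressor m idx y u k \<omega> =
     (\<chi> c. if idx c \<le> m then - y (k - int (idx c)) \<omega> else u (k - int (idx c - m)) \<omega>)"

primrec rls_P :: "(nat \<Rightarrow> real ^ 'd) \<Rightarrow> real ^ 'd ^ 'd \<Rightarrow> nat \<Rightarrow> real ^ 'd ^ 'd" where
  "rls_P \<phi> P0 0 = P0"
| "rls_P \<phi> P0 (Suc k) =
     (let P = rls_P \<phi> P0 k; v = \<phi> (Suc k); \<alpha> = inverse (1 + v \<bullet> (P *v v))
      in P - \<alpha> *\<^sub>R (P ** outer_product v v ** P))"

primrec rls_estimate ::
    "(nat \<Rightarrow> real ^ 'd) \<Rightarrow> (nat \<Rightarrow> real) \<Rightarrow> real ^ 'd \<Rightarrow> real ^ 'd ^ 'd \<Rightarrow> nat \<Rightarrow> real ^ 'd" where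
  "rls_estimate \<phi> y \<theta>0 P0 0 = \<theta>0"
| "rls_estimate \<phi> y \<theta>0 P0 (Suc k) =
     (let \<theta> = rls_estimate \<phi> y \<theta>0 P0 k; P = rls_P \<phi> P0 k; v = \<phi> (Suc k);
          \<alpha> = inverse (1 + v \<bullet> (P *v v))
      in \<theta> + (\<alpha> * (y (Suc k) - v \<bullet> \<theta>)) *\<^sub>R (P *v v))"

definition arx_stable :: "nat \<Rightarrow> (nat \<Rightarrow> real) \<Rightarrow> bool" where
  "arx_stable m a \<longleftrightarrow>
     (\<forall>z::complex. norm z \<le> 1 \<longrightarrow> 1 + (\<Sum>i=1..m. complex_of_real (a i) * z ^ i) \<noteq> 0)"

context prob_space
begin

definition arx_system ::
    "nat \<Rightarrow> nat \<Rightarrow> (nat \<Rightarrow> real) \<Rightarrow> (nat \<Rightarrow> real) \<Rightarrow>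
      (int \<Rightarrow> 'a \<Rightarrow> real) \<Rightarrow> (int \<Rightarrow> 'a \<Rightarrow> real) \<Rightarrow> (int \<Rightarrow> 'a \<Rightarrow> real) \<Rightarrow> bool" where
  "arx_system m n a b y u d \<longleftrightarrow>
     (\<forall>k\<le>0. \<forall>\<omega>\<in>space M. y k \<omega> = 0) \<and>
     (\<forall>k<0. \<forall>\<omega>\<in>space M. u k \<omega> = 0) \<and>
     (\<forall>k\<ge>1. AE \<omega> in M.
        y k \<omega> + (\<Sum>i=1..m. a i * y (k - int i) \<omega>) =
        (\<Sum>i=1..n. b i * u (k - int i) \<omega>) + d k \<omega>)"

definition has_avg_expectation ::
    "(int \<Rightarrow> 'a \<Rightarrow> 'b::{banach,second_countable_topology}) \<Rightarrow> 'b \<Rightarrow> bool" where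
  "has_avg_expectation t L \<longleftrightarrow>
     (\<lambda>k::nat. (1 / real k) *\<^sub>R (\<Sum>l=1..k. expectation (t (int l)))) \<longlonglongrightarrow> L"

text \<open>
  The integrability clauses make explicit that the expectations exist, since the Bochner
  integral of a non-integrable function is 0. Processes are extended by 0 to the
  indices where they are not defined, which does not affect the suprema.
\<close>

definition quasi_stationary :: "(int \<Rightarrow> 'a \<Rightarrow> real) \<Rightarrow> bool" where
  "quasi_stationary t \<longleftrightarrow>
     (\<exists>C>0. (\<forall>k. integrable M (t k) \<and> \<bar>expectation (t k)\<bar> < C) \<and>
            (\<forall>i j. integrable M (\<lambda>\<omega>. t i \<omega> * t j \<omega>) \<and>
                   \<bar>expectation (\<lambda>\<omega>. t i \<omega> * t j \<omega>)\<bar> < C)) \<and>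
     (\<forall>\<tau>. \<exists>R. has_avg_expectation (\<lambda>k \<omega>. t k \<omega> * t (k - \<tau>) \<omega>) R)"

text \<open>
  Here \<open>f j i k\<close> is the coefficient \<open>f\<^sub>i\<^sup>(\<^sup>j\<^sup>)(k)\<close>. The series below have only
  finitely many nonzero terms, because \<open>r\<close> and \<open>e\<close> vanish at negative times.
\<close>

definition filter_representation ::
    "(int \<Rightarrow> real) \<Rightarrow> (int \<Rightarrow> 'a \<Rightarrow> real) \<Rightarrow> (nat \<Rightarrow> nat \<Rightarrow> int \<Rightarrow> real) \<Rightarrow>
      (int \<Rightarrow> 'a \<Rightarrow> real) \<Rightarrow> (int \<Rightarrow> 'a \<Rightarrow> real) \<Rightarrow> bool" where
  "filter_representation r e f y u \<longleftrightarrow>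
     (\<forall>k\<ge>1. AE \<omega> in M.
        y k \<omega> = (\<Sum>i. f 1 (Suc i) k * r (k - int (Suc i))) + (\<Sum>i. f 2 i k * e (k - int i) \<omega>)) \<and>
     (\<forall>k\<ge>0. AE \<omega> in M.
        u k \<omega> = (\<Sum>i. f 3 i k * r (k - int i)) + (\<Sum>i. f 4 i k * e (k - int i) \<omega>))"

definition uniformly_stable :: "(nat \<Rightarrow> nat \<Rightarrow> int \<Rightarrow> real) \<Rightarrow> bool" where
  "uniformly_stable f \<longleftrightarrow>
     (\<exists>g::nat \<Rightarrow> real.
        (\<forall>i\<ge>1. \<forall>k\<ge>1. \<bar>f 1 i k\<bar> \<le> \<bar>g i\<bar>) \<and>
        (\<forall>i. \<forall>k\<ge>1. \<bar>f 2 i k\<bar> \<le> \<bar>g i\<bar>) \<and>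
        (\<forall>i. \<forall>k\<ge>0. \<bar>f 3 i k\<bar> \<le> \<bar>g i\<bar>) \<and>
        (\<forall>i. \<forall>k\<ge>0. \<bar>f 4 i k\<bar> \<le> \<bar>g i\<bar>) \<and>
        summable (\<lambda>i. \<bar>g i\<bar>))"

definition persistently_exciting ::
    "nat \<Rightarrow> ('d::finite \<Rightarrow> nat) \<Rightarrow> (int \<Rightarrow> 'a \<Rightarrow> real) \<Rightarrow> (int \<Rightarrow> 'a \<Rightarrow> real) \<Rightarrow> bool" where
  "persistently_exciting m idx y u \<longleftrightarrow>
     (\<exists>R. has_avg_expectation
            (\<lambda>k \<omega>. outer_product (regressor m idx y u k \<omega>) (regressor m idx y u k \<omega>)) R \<and>
          positive_definite R)"

definition assumption_A ::
    "nat \<Rightarrow> nat \<Rightarrow> ('d::finite \<Rightarrow> nat) \<Rightarrow> (int \<Rightarrow> 'a \<Rightarrow> real) \<Rightarrow> (int \<Rightarrow> 'a \<Rightarrow> real) \<Rightarrow> bool" where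
  "assumption_A \<gamma> m idx y u \<longleftrightarrow>
     (\<exists>r e \<delta>\<^sub>e f.
        bounded (range r) \<and> (\<forall>k<0. r k = 0) \<and>
        (\<forall>k<0. \<forall>\<omega>\<in>space M. e k \<omega> = 0) \<and>
        indep_vars (\<lambda>_. borel) e {0..} \<and>
        (\<forall>k\<ge>0. expectation (e k) = 0 \<and> variance (e k) = \<delta>\<^sub>e\<^sup>2) \<and>
        (\<exists>K. \<forall>k\<ge>0. integrable M (\<lambda>\<omega>. \<bar>e k \<omega>\<bar> ^ (4 * \<gamma>)) \<and>
                     expectation (\<lambda>\<omega>. \<bar>e k \<omega>\<bar> ^ (4 * \<gamma>)) \<le> K) \<and>
        filter_representation r e f y u \<and>
        uniformly_stable f) \<and>
     quasi_stationary y \<and> quasi_stationary u \<and>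
     (\<forall>\<tau>. \<exists>R. has_avg_expectation (\<lambda>k \<omega>. y k \<omega> * u (k - \<tau>) \<omega>) R) \<and>
     persistently_exciting m idx y u"

text \<open>The degenerate Gaussian law of variance 0 (a point mass) is included.\<close>

definition gaussian_rv :: "real \<Rightarrow> real \<Rightarrow> ('a \<Rightarrow> real) \<Rightarrow> bool" where
  "gaussian_rv \<mu> \<sigma> X \<longleftrightarrow>
     random_variable borel X \<and>
     (if \<sigma> = 0 then AE \<omega> in M. X \<omega> = \<mu> else distributed M lborel X (normal_density \<mu> \<sigma>))"

definition gaussian_noise :: "(int \<Rightarrow> 'a \<Rightarrow> real) \<Rightarrow> real \<Rightarrow> bool" where
  "gaussian_noise d \<delta>\<^sub>d \<longleftrightarrow>
     indep_vars (\<lambda>_. borel) d {1..} \<and> (\<forall>k\<ge>1. gaussian_rv 0 \<delta>\<^sub>d (d k))"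

text \<open>
  The standing convention that \<open>d\<^sub>k\<close> is noise relative to the data available before time
  \<open>k\<close>, in its weakest form: \<open>d\<^sub>k\<close> is uncorrelated with every entry of \<open>\<phi>\<^sub>k\<close>. For
  centred \<open>d\<^sub>k\<close> it holds whenever \<open>d\<^sub>k\<close> is independent of \<open>\<phi>\<^sub>k\<close>. It does not follow
  from the other assumptions, and consistency fails without it: for independent standard
  Gaussian \<open>e\<^sub>k\<close>, \<open>r = 0\<close>, \<open>u\<^sub>k = e\<^sub>k\<close>, \<open>d\<^sub>k = e\<^sub>k\<^sub>-\<^sub>1\<close>
  and \<open>y\<^sub>k + a y\<^sub>k\<^sub>-\<^sub>1 = u\<^sub>k\<^sub>-\<^sub>1 + d\<^sub>k = 2 u\<^sub>k\<^sub>-\<^sub>1\<close> with \<open>\<bar>a\<bar> < 1\<close>,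
  least squares converges to \<open>(a, 2)\<close> instead of \<open>(a, 1)\<close>.
\<close>

definition noise_uncorrelated_with_regressor ::
    "nat \<Rightarrow> ('d::finite \<Rightarrow> nat) \<Rightarrow> (int \<Rightarrow> 'a \<Rightarrow> real) \<Rightarrow> (int \<Rightarrow> 'a \<Rightarrow> real) \<Rightarrow>
      (int \<Rightarrow> 'a \<Rightarrow> real) \<Rightarrow> bool" where
  "noise_uncorrelated_with_regressor m idx y u d \<longleftrightarrow>
     (\<forall>k\<ge>1. \<forall>c. expectation (\<lambda>\<omega>. regressor m idx y u k \<omega> $ c * d k \<omega>) = 0)"

end

end

theory Submission
  imports Defs
begin

text \<open>
  The ARX equation expresses the noise \<open>d\<close> through delayed outputs and inputs. Outputs and inputs are
  uniformly stable linear filters of a bounded deterministic signal and the independent innovations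
  \<open>e\<close>, hence so are the noise and all entries of the regressor \<open>\<phi>\<close> (\<open>lin_filter\<close>). All random
  quantities in the analysis of the estimates are therefore sums over time of products of two such
  filtered signals.

  The probabilistic core is \<open>lin_filter_centred_sum_bound\<close>: a sum of \<open>k\<close> centred products of filtered
  signals has a moment of order \<open>2 * \<gamma>\<close> bounded by a multiple of \<open>k\<^sup>\<gamma>\<close>, as if the summands were
  independent. By Jensen's inequality over the filter coefficients it reduces to weighted sums of
  centred products \<open>e (l - i) * e (l - j)\<close> with fixed delays. Such a sum has increments that are
  orthogonal to the powers of its past values, and \<open>orthogonal_increments_moment_bound\<close> applies. The bound is used
  twice: for the deviation of \<open>\<Sum> \<phi> \<phi>\<^sup>T\<close> from its mean, and for \<open>\<Sum> d \<phi>\<close>, whose mean is 0 because the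
  noise is uncorrelated with the regressor.

  The estimation error \<open>x\<close> after \<open>k\<close> steps satisfies the normal equations
  \<open>(P0\<^sup>-\<^sup>1 + \<Sum> \<phi> \<phi>\<^sup>T) x = P0\<^sup>-\<^sup>1 x0 + \<Sum> d \<phi>\<close> (\<open>information_error\<close>), where \<open>x0\<close> is the initial error.
  They give two bounds. If \<open>\<Sum> \<phi> \<phi>\<^sup>T\<close> is at least a multiple of \<open>k\<close> times the identity, then
  \<open>\<bar>x\<bar>\<close> is at most a multiple of \<open>(1 + \<bar>\<Sum> d \<phi>\<bar>) / k\<close>, which is of order \<open>k\<^sup>-\<^sup>1\<^sup>/\<^sup>2\<close>. Without excitation,
  \<open>\<bar>x\<bar>\<^sup>2\<close> is still at most a multiple of \<open>1 + \<Sum> d\<^sup>2\<close>, which is of order \<open>k\<close>. By persistent excitation and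
  the moment bound, excitation fails with probability \<open>O(k\<^sup>-\<^sup>\<gamma>)\<close>, and this compensates for the loss of
  a factor \<open>k\<close> in the crude bound (\<open>rls_moment_rate\<close>).
\<close>

section \<open>Inequalities for real powers\<close>

text \<open>
  Only the term of first order in \<open>b\<close> of the binomial expansion has a sign that matters; it vanishes
  in expectation when \<open>b\<close> is an increment orthogonal to the past. Every term of order at least two
  is at most \<open>a\<^sup>2\<^sup>\<gamma> / s\<^sup>2\<close> when \<open>s \<bar>b\<bar> \<le> \<bar>a\<bar>\<close> and at most \<open>s\<^sup>2\<^sup>\<gamma>\<^sup>-\<^sup>2 b\<^sup>2\<^sup>\<gamma>\<close> otherwise. The parameter
  \<open>s\<close> is free so that it can be matched to the length of the sum under study.
\<close>

lemma even_power_step: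
  fixes a b s :: real
  assumes "s \<ge> 1" and "\<gamma> \<ge> 1"
  shows "(a + b) ^ (2 * \<gamma>) \<le> a ^ (2 * \<gamma>) + 2 * \<gamma> * (a ^ (2 * \<gamma> - 1) * b)
           + 4 ^ \<gamma> * (a ^ (2 * \<gamma>) / s\<^sup>2 + s ^ (2 * (\<gamma> - 1)) * b ^ (2 * \<gamma>))"
proof -
  define p where "p = 2 * \<gamma>"
  define T where "T = a ^ p / s\<^sup>2 + s ^ (2 * (\<gamma> - 1)) * b ^ p"
  have p2: "p \<ge> 2" and ev: "even p" and ps: "p - 2 = 2 * (\<gamma> - 1)"
    using assms by (auto simp: p_def)
  have abs_p: "\<bar>x\<bar> ^ p = x ^ p" for x :: real using ev by (simp add: power_even_abs)
  have T1: "a ^ p / s\<^sup>2 \<le> T" "s ^ (2 * (\<gamma> - 1)) * b ^ p \<le> T" "0 \<le> T"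
    using ev assms unfolding T_def by (auto simp: zero_le_even_power)
  have mono: "\<bar>a\<bar> ^ (p - j) * \<bar>b\<bar> ^ j \<le> T" if j: "2 \<le> j" "j \<le> p" for j
  proof (cases "s * \<bar>b\<bar> \<le> \<bar>a\<bar>")
    case True
    have le: "\<bar>b\<bar> \<le> \<bar>a\<bar>" using True assms(1) mult_right_mono[of 1 s "\<bar>b\<bar>"] by simp
    have "\<bar>a\<bar> ^ (p - j) * \<bar>b\<bar> ^ j = \<bar>a\<bar> ^ (p - j) * (\<bar>b\<bar> ^ (j - 2) * \<bar>b\<bar>\<^sup>2)"
      using j by (simp only: le_add_diff_inverse2 flip: power_add)
    also have "\<dots> \<le> \<bar>a\<bar> ^ (p - j) * (\<bar>a\<bar> ^ (j - 2) * \<bar>b\<bar>\<^sup>2)"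
      using le by (intro mult_left_mono mult_right_mono power_mono) auto
    also have "\<dots> = \<bar>a\<bar> ^ (p - 2) * \<bar>b\<bar>\<^sup>2"
      using j by (simp flip: power_add mult.assoc)
    also have "\<dots> \<le> \<bar>a\<bar> ^ (p - 2) * (\<bar>a\<bar>\<^sup>2 / s\<^sup>2)"
    proof -
      have "(s * \<bar>b\<bar>)\<^sup>2 \<le> \<bar>a\<bar>\<^sup>2" using True assms(1) by (intro power_mono) auto
      then show ?thesis using assms(1)
        by (intro mult_left_mono) (auto simp: field_simps power_mult_distrib)
    qed
    also have "\<dots> = a ^ p / s\<^sup>2"
      using p2 by (metis abs_p le_add_diff_inverse2 power_add times_divide_eq_right)
    finally show ?thesis using T1 by linarith
  next
    case False
    have "\<bar>a\<bar> ^ (p - j) * \<bar>b\<bar> ^ j \<le> (s * \<bar>b\<bar>) ^ (p - j) * \<bar>b\<bar> ^ j"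
      using False by (intro mult_right_mono power_mono) auto
    also have "\<dots> = s ^ (p - j) * b ^ p"
      using j by (simp add: power_mult_distrib abs_p flip: power_add)
    also have "\<dots> \<le> s ^ (2 * (\<gamma> - 1)) * b ^ p"
      using assms(1) j ps ev by (intro mult_right_mono power_increasing) (auto simp: zero_le_even_power)
    finally show ?thesis using T1 by linarith
  qed
  let ?t = "\<lambda>j. of_nat (p choose j) * a ^ j * b ^ (p - j)"
  let ?u = "\<lambda>j. of_nat (p choose j) * b ^ j * a ^ (p - j)"
  have "(a + b) ^ p = (\<Sum>j\<le>p. ?u j)" by (simp add: add.commute[of a b] binomial_ring)
  also have "{..p} = insert 0 (insert 1 {2..p})" using p2 by auto
  also have "sum ?u (insert 0 (insert 1 {2..p})) = a ^ p + p * (a ^ (p - 1) * b) + sum ?u {2..p}"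
    by simp
  also have "sum ?u {2..p} \<le> (\<Sum>j\<in>{2..p}. of_nat (p choose j) * T)"
  proof (rule sum_mono)
    fix j assume j: "j \<in> {2..p}"
    have "b ^ j * a ^ (p - j) \<le> \<bar>a\<bar> ^ (p - j) * \<bar>b\<bar> ^ j"
      by (metis abs_ge_self abs_mult mult.commute power_abs)
    also have "\<dots> \<le> T" using mono j by auto
    finally show "?u j \<le> of_nat (p choose j) * T"
      by (simp add: mult.assoc mult_left_mono)
  qed
  also have "\<dots> \<le> (\<Sum>j\<le>p. of_nat (p choose j) * T)"
    using T1 by (intro sum_mono2) auto
  also have "\<dots> = 4 ^ \<gamma> * T"
    by (simp flip: sum_distrib_right of_nat_sum add: choose_row_sum p_def power_mult)
  finally show ?thesis unfolding T_def p_def by simp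
qed


text \<open>
  Jensen's inequality for an even power, with weights that need not add up to one.
\<close>

lemma weighted_sum_power_le:
  fixes w x :: "'i \<Rightarrow> real"
  assumes "finite I" and w: "\<And>i. i \<in> I \<Longrightarrow> w i \<ge> 0" and "even p" "p > 0"
  shows "(\<Sum>i\<in>I. w i * x i) ^ p \<le> (\<Sum>i\<in>I. w i) ^ (p - 1) * (\<Sum>i\<in>I. w i * x i ^ p)"
proof (cases "sum w I = 0")
  case True
  then have "\<And>i. i \<in> I \<Longrightarrow> w i = 0" using assms by (simp add: sum_nonneg_eq_0_iff)
  then show ?thesis using assms by (simp add: power_0_left)
next
  case False
  define W where "W = sum w I"
  have W: "W > 0" using False w by (simp add: W_def sum_nonneg order_less_le)
  have "(\<Sum>i\<in>I. (w i / W) *\<^sub>R x i) ^ p \<le> (\<Sum>i\<in>I. (w i / W) * x i ^ p)"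
    using False W assms
    by (intro convex_on_sum[OF _ _ convex_power_even]) (auto simp flip: sum_divide_distrib simp: W_def)
  moreover have "(\<Sum>i\<in>I. (w i / W) *\<^sub>R x i) = (\<Sum>i\<in>I. w i * x i) / W"
    by (simp add: sum_divide_distrib)
  moreover have "(\<Sum>i\<in>I. (w i / W) * x i ^ p) = (\<Sum>i\<in>I. w i * x i ^ p) / W"
    by (simp add: sum_divide_distrib)
  ultimately have "(\<Sum>i\<in>I. w i * x i) ^ p \<le> W ^ p * ((\<Sum>i\<in>I. w i * x i ^ p) / W)"
    using W by (simp add: power_divide pos_divide_le_eq mult.commute)
  also have "\<dots> = W ^ (p - 1) * (\<Sum>i\<in>I. w i * x i ^ p)"
    using W \<open>p > 0\<close> by (cases p) auto
  finally show ?thesis unfolding W_def .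
qed

lemma abs_power_le_even_power:
  fixes x :: real
  assumes "q \<le> p" "even p"
  shows "\<bar>x\<bar> ^ q \<le> 1 + x ^ p"
proof (cases "\<bar>x\<bar> \<le> 1")
  case True
  then have "\<bar>x\<bar> ^ q \<le> 1" by (simp add: power_le_one)
  moreover have "0 \<le> x ^ p" using assms by (simp add: zero_le_even_power)
  ultimately show ?thesis by linarith
next
  case False
  then have "\<bar>x\<bar> ^ q \<le> \<bar>x\<bar> ^ p" using assms by (intro power_increasing) auto
  then show ?thesis using assms by (simp add: power_even_abs)
qed

lemma abs_power_mult_power_le:
  fixes x y :: real
  assumes "i + j = p" "even p"
  shows "\<bar>x\<bar> ^ i * \<bar>y\<bar> ^ j \<le> x ^ p + y ^ p"
proof -
  define z where "z = max \<bar>x\<bar> \<bar>y\<bar>"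
  have "\<bar>x\<bar> ^ i * \<bar>y\<bar> ^ j \<le> z ^ i * z ^ j"
    by (intro mult_mono power_mono) (auto simp: z_def)
  also have "\<dots> = z ^ p" using assms by (simp flip: power_add)
  also have "\<dots> \<le> \<bar>x\<bar> ^ p + \<bar>y\<bar> ^ p" by (auto simp: z_def max_def)
  finally show ?thesis using assms by (simp add: power_even_abs)
qed

lemma power_add_le_even:
  fixes x y :: real
  assumes "even p"
  shows "(x + y) ^ p \<le> 2 ^ p * (x ^ p + y ^ p)"
proof -
  define z where "z = max \<bar>x\<bar> \<bar>y\<bar>"
  have "(x + y) ^ p = \<bar>x + y\<bar> ^ p" using assms by (simp add: power_even_abs)
  also have "\<dots> \<le> (2 * z) ^ p" by (intro power_mono) (auto simp: z_def)
  also have "\<dots> = 2 ^ p * z ^ p" by (simp add: power_mult_distrib)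
  also have "\<dots> \<le> 2 ^ p * (\<bar>x\<bar> ^ p + \<bar>y\<bar> ^ p)"
    by (intro mult_left_mono) (auto simp: z_def max_def)
  finally show ?thesis using assms by (simp add: power_even_abs)
qed

lemma powr_le_one_plus_power:
  fixes t :: real
  assumes "t \<ge> 0" "0 \<le> r" "r \<le> real p"
  shows "t powr r \<le> 1 + t ^ p"
proof (cases "t \<le> 1")
  case True
  then have "t powr r \<le> 1" using assms by (intro powr_le1) auto
  then show ?thesis using assms by (simp add: add_increasing2)
next
  case False
  then have "t powr r \<le> t powr (real p)" using assms by (intro powr_mono) auto
  then show ?thesis using False by (simp add: powr_realpow)
qed

text \<open>
  This and the next lemma replace Hoelder's inequality: they bound the scaled fractional power of the
  error pointwise by integer powers, whose expectations are bounded.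
\<close>

lemma scaled_error_power_le_good:
  fixes n A h :: real and k \<gamma> :: nat
  assumes "k > 0" "h > 0" "n \<ge> 0" "n \<le> A / (h * k)"
  shows "real k powr (\<gamma> / 4) * n powr (\<gamma> / 2) \<le> 1 + (A / h) ^ (2 * \<gamma>) / real k ^ \<gamma>"
proof -
  have A: "A / h \<ge> 0" using assms by (smt (verit) divide_neg_pos mult_pos_pos of_nat_0_less_iff zero_le_divide_iff)
  have "real k powr (\<gamma> / 4) * n powr (\<gamma> / 2) = (sqrt k * n) powr (\<gamma> / 2)"
    using assms by (simp add: powr_mult powr_half_sqrt[symmetric] powr_powr)
  also have "\<dots> \<le> 1 + (sqrt k * n) ^ (2 * \<gamma>)"
    using assms by (intro powr_le_one_plus_power) auto
  also have "(sqrt k * n) ^ (2 * \<gamma>) = (k * n\<^sup>2) ^ \<gamma>"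
    by (simp add: power_mult power_mult_distrib)
  also have "\<dots> \<le> ((A / h)\<^sup>2 / k) ^ \<gamma>"
  proof (intro power_mono)
    have "n\<^sup>2 \<le> (A / (h * k))\<^sup>2" using assms by (intro power_mono) auto
    then have "k * n\<^sup>2 \<le> k * (A / (h * k))\<^sup>2" by (intro mult_left_mono) auto
    also have "\<dots> = (A / h)\<^sup>2 / k" using assms by (simp add: field_simps power2_eq_square)
    finally show "k * n\<^sup>2 \<le> (A / h)\<^sup>2 / k" .
  qed auto
  also have "\<dots> = (A / h) ^ (2 * \<gamma>) / real k ^ \<gamma>" by (simp add: power_divide power_mult power_mult_distrib)
  finally show ?thesis by simp
qed

text \<open>
  The summand \<open>k\<^sup>\<gamma>\<close> is affordable because this estimate is used only on an event of probability
  \<open>O(k\<^sup>-\<^sup>\<gamma>)\<close>. It comes from splitting \<open>k n\<^sup>2 = k\<^sup>2 (n\<^sup>2 / k)\<close> and from \<open>x y \<le> x\<^sup>2 + y\<^sup>2\<close>.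
\<close>

lemma scaled_error_power_le_bad:
  fixes n U :: real and k \<gamma> :: nat
  assumes "k > 0" "n \<ge> 0" "n\<^sup>2 \<le> U"
  shows "real k powr (\<gamma> / 4) * n powr (\<gamma> / 2) \<le> real k ^ \<gamma> + (1 + (U / real k) ^ (2 * \<gamma>))"
proof -
  define Y where "Y = n / sqrt k"
  define s where "s = real k powr (\<gamma> / 2)"
  have Y: "Y \<ge> 0" using assms by (simp add: Y_def)
  have "real k powr (\<gamma> / 4) * n powr (\<gamma> / 2) = (sqrt k * n) powr (\<gamma> / 2)"
    using assms by (simp add: powr_mult powr_half_sqrt[symmetric] powr_powr)
  also have "sqrt k * n = k * Y"
    using assms by (simp add: Y_def field_simps flip: power2_eq_square)
  also have "(k * Y) powr (\<gamma> / 2) = s * Y powr (\<gamma> / 2)"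
    using Y by (simp add: powr_mult s_def)
  also have "\<dots> \<le> s\<^sup>2 + (Y powr (\<gamma> / 2))\<^sup>2"
  proof -
    have "0 \<le> s * Y powr (\<gamma> / 2)" by (simp add: s_def)
    then show ?thesis using sum_squares_bound[of s "Y powr (\<gamma> / 2)"] by linarith
  qed
  also have "s\<^sup>2 = real k ^ \<gamma>"
    using assms by (simp add: s_def powr_powr powr_realpow flip: powr_numeral)
  also have "(Y powr (\<gamma> / 2))\<^sup>2 = Y powr \<gamma>"
    by (simp add: power2_eq_square flip: powr_add)
  also have "Y powr \<gamma> \<le> 1 + Y ^ (4 * \<gamma>)"
    using Y by (intro powr_le_one_plus_power) auto
  also have "Y ^ (4 * \<gamma>) = (n\<^sup>2 / k) ^ (2 * \<gamma>)"
  proof -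
    have "Y ^ (4 * \<gamma>) = (Y\<^sup>2) ^ (2 * \<gamma>)" by (simp flip: power_mult)
    then show ?thesis by (simp add: Y_def power_divide)
  qed
  also have "\<dots> \<le> (U / real k) ^ (2 * \<gamma>)"
    using assms by (intro power_mono divide_right_mono) auto
  finally show ?thesis by simp
qed

section \<open>Moments of sums with orthogonal increments\<close>

context prob_space
begin

lemma integrable_power_add:
  fixes X Y :: "'a \<Rightarrow> real"
  assumes "even p" "random_variable borel X" "random_variable borel Y"
    and "integrable M (\<lambda>\<omega>. X \<omega> ^ p)" "integrable M (\<lambda>\<omega>. Y \<omega> ^ p)"
  shows "integrable M (\<lambda>\<omega>. (X \<omega> + Y \<omega>) ^ p)"
proof (rule Bochner_Integration.integrable_bound)
  show "integrable M (\<lambda>\<omega>. 2 ^ p * (X \<omega> ^ p + Y \<omega> ^ p))" using assms by auto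
  show "AE \<omega> in M. norm ((X \<omega> + Y \<omega>) ^ p) \<le> norm (2 ^ p * (X \<omega> ^ p + Y \<omega> ^ p))"
    using assms power_add_le_even[OF assms(1)]
    by (intro AE_I2) (simp add: zero_le_even_power abs_mult)
qed (use assms in measurable)

lemma integrable_power_sum:
  fixes X :: "'i \<Rightarrow> 'a \<Rightarrow> real"
  assumes "finite I" "even p" "p > 0" "\<And>i. i \<in> I \<Longrightarrow> random_variable borel (X i)"
    and "\<And>i. i \<in> I \<Longrightarrow> integrable M (\<lambda>\<omega>. X i \<omega> ^ p)"
  shows "integrable M (\<lambda>\<omega>. (\<Sum>i\<in>I. X i \<omega>) ^ p)"
  using assms(1,4,5)
proof (induction I rule: finite_induct)
  case empty
  then show ?case using assms by (simp add: power_0_left)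
next
  case (insert i I)
  then show ?case using assms(2) by (simp, intro integrable_power_add) auto
qed

lemma integrable_lower_power:
  fixes X :: "'a \<Rightarrow> real"
  assumes "q \<le> p" "even p" "random_variable borel X" "integrable M (\<lambda>\<omega>. X \<omega> ^ p)"
  shows "integrable M (\<lambda>\<omega>. X \<omega> ^ q)"
proof (rule Bochner_Integration.integrable_bound)
  show "integrable M (\<lambda>\<omega>. 1 + X \<omega> ^ p)" using assms by auto
  show "AE \<omega> in M. norm (X \<omega> ^ q) \<le> norm (1 + X \<omega> ^ p)"
    using assms abs_power_le_even_power[OF assms(1,2)]
    by (intro AE_I2) (simp add: zero_le_even_power power_abs)
qed (use assms in measurable)

lemma integrable_power_mult_power:
  fixes X Y :: "'a \<Rightarrow> real"
  assumes "i + j = p" "even p" "random_variable borel X" "random_variable borel Y"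
    and "integrable M (\<lambda>\<omega>. X \<omega> ^ p)" "integrable M (\<lambda>\<omega>. Y \<omega> ^ p)"
  shows "integrable M (\<lambda>\<omega>. X \<omega> ^ i * Y \<omega> ^ j)"
proof (rule Bochner_Integration.integrable_bound)
  show "integrable M (\<lambda>\<omega>. X \<omega> ^ p + Y \<omega> ^ p)" using assms by auto
  show "AE \<omega> in M. norm (X \<omega> ^ i * Y \<omega> ^ j) \<le> norm (X \<omega> ^ p + Y \<omega> ^ p)"
    using assms abs_power_mult_power_le[OF assms(1,2)]
    by (intro AE_I2) (simp add: zero_le_even_power power_abs abs_mult)
qed (use assms in measurable)

lemma abs_expectation_le:
  assumes "random_variable borel X" "even p" "p > 0" "integrable M (\<lambda>\<omega>. X \<omega> ^ p)"
  shows "\<bar>expectation X\<bar> \<le> 1 + expectation (\<lambda>\<omega>. X \<omega> ^ p :: real)"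
proof -
  have X: "integrable M X" using integrable_lower_power[of 1 p X] assms by simp
  have "\<bar>expectation X\<bar> \<le> expectation (\<lambda>\<omega>. \<bar>X \<omega>\<bar>)" by (rule integral_abs_bound)
  also have "\<dots> \<le> expectation (\<lambda>\<omega>. 1 + X \<omega> ^ p)"
    using X assms abs_power_le_even_power[of 1 p] by (intro integral_mono) auto
  also have "\<dots> = 1 + expectation (\<lambda>\<omega>. X \<omega> ^ p)" using assms by (simp add: prob_space)
  finally show ?thesis .
qed

text \<open>
  An inequality of Burkholder type. Conditioning is replaced by the single orthogonality relation
  between the increment and the odd power \<open>2 * \<gamma> - 1\<close> of the preceding partial sum, which is all
  that \<open>even_power_step\<close> requires. With the horizon \<open>k\<close> fixed and \<open>s\<^sup>2 = k\<close>, one step multiplies the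
  moment by at most \<open>1 + 4\<^sup>\<gamma> / k\<close> and adds a quantity of order \<open>k\<^sup>\<gamma>\<^sup>-\<^sup>1\<close>; over \<open>k\<close> steps the factors stay
  below \<open>exp (4\<^sup>\<gamma>)\<close> and the additions amount to order \<open>k\<^sup>\<gamma>\<close>.
\<close>

lemma orthogonal_increments_moment_bound:
  fixes X :: "nat \<Rightarrow> 'a \<Rightarrow> real"
  assumes \<gamma>: "\<gamma> \<ge> 1"
    and X[measurable]: "\<And>l. random_variable borel (X l)"
    and int: "\<And>l. integrable M (\<lambda>\<omega>. X l \<omega> ^ (2 * \<gamma>))"
    and bound: "\<And>l. expectation (\<lambda>\<omega>. X l \<omega> ^ (2 * \<gamma>)) \<le> K"
    and orth: "\<And>l. expectation (\<lambda>\<omega>. (\<Sum>j<l. X j \<omega>) ^ (2 * \<gamma> - 1) * X l \<omega>) = 0"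
  shows "expectation (\<lambda>\<omega>. (\<Sum>j<k. X j \<omega>) ^ (2 * \<gamma>)) \<le> 4 ^ \<gamma> * exp (4 ^ \<gamma>) * K * k ^ \<gamma>"
proof (cases "k = 0")
  case True
  then show ?thesis using \<gamma> by (simp add: power_0_left)
next
  case False
  define p where "p = 2 * \<gamma>"
  define S where "S l \<omega> = (\<Sum>j<l. X j \<omega>)" for l \<omega>
  define c :: real where "c = 4 ^ \<gamma>"
  have S[measurable]: "random_variable borel (S l)" for l unfolding S_def by measurable
  have p: "even p" "p > 0" using \<gamma> by (auto simp: p_def)
  have intX: "integrable M (\<lambda>\<omega>. X l \<omega> ^ p)" for l using int by (simp add: p_def)
  have intS: "integrable M (\<lambda>\<omega>. S l \<omega> ^ p)" for l
    unfolding S_def using p intX by (intro integrable_power_sum) auto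
  have intSX: "integrable M (\<lambda>\<omega>. S l \<omega> ^ (p - 1) * X l \<omega>)" for l
    using integrable_power_mult_power[of "p - 1" 1 p "S l" "X l"] p intS intX by simp
  have c0: "c \<ge> 0" by (simp add: c_def)
  have K0: "K \<ge> 0"
    by (intro order_trans[OF Bochner_Integration.integral_nonneg bound[of 0]])
      (simp add: zero_le_even_power)
  \<comment> \<open>The growth factor of one step for the horizon k, so that its k-th power is at most exp c.\<close>
  define q where "q = 1 + c / k"
  have q1: "q \<ge> 1" using c0 by (simp add: q_def)
  have step: "expectation (\<lambda>\<omega>. S (Suc l) \<omega> ^ p)
      \<le> q * expectation (\<lambda>\<omega>. S l \<omega> ^ p) + c * k ^ (\<gamma> - 1) * K" for l
  proof -
    have "S (Suc l) \<omega> ^ p \<le> q * S l \<omega> ^ p + p * (S l \<omega> ^ (p - 1) * X l \<omega>)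
             + c * k ^ (\<gamma> - 1) * X l \<omega> ^ p" for \<omega>
    proof -
      have "sqrt k ^ (2 * (\<gamma> - 1)) = k ^ (\<gamma> - 1)" by (simp add: power_mult)
      then show ?thesis
        using even_power_step[of "sqrt k" \<gamma> "S l \<omega>" "X l \<omega>"] False \<gamma>
        by (simp add: S_def p_def c_def q_def algebra_simps)
    qed
    then have "expectation (\<lambda>\<omega>. S (Suc l) \<omega> ^ p)
      \<le> expectation (\<lambda>\<omega>. q * S l \<omega> ^ p + p * (S l \<omega> ^ (p - 1) * X l \<omega>)
             + c * k ^ (\<gamma> - 1) * X l \<omega> ^ p)"
      using intS intX intSX by (intro integral_mono) auto
    also have "\<dots> = q * expectation (\<lambda>\<omega>. S l \<omega> ^ p) + c * k ^ (\<gamma> - 1) * expectation (\<lambda>\<omega>. X l \<omega> ^ p)"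
      using intS intX intSX orth[of l] by (simp add: S_def p_def)
    also have "c * k ^ (\<gamma> - 1) * expectation (\<lambda>\<omega>. X l \<omega> ^ p) \<le> c * k ^ (\<gamma> - 1) * K"
      using bound[of l] c0 by (intro mult_left_mono) (auto simp: p_def)
    finally show ?thesis by simp
  qed
  have "expectation (\<lambda>\<omega>. S l \<omega> ^ p) \<le> q ^ l * (l * (c * k ^ (\<gamma> - 1) * K))" for l
  proof (induction l)
    case 0
    then show ?case using p by (simp add: S_def power_0_left)
  next
    case (Suc l)
    define h where "h = c * k ^ (\<gamma> - 1) * K"
    have h0: "h \<ge> 0" using c0 K0 by (simp add: h_def)
    have "expectation (\<lambda>\<omega>. S (Suc l) \<omega> ^ p) \<le> q * (q ^ l * (l * h)) + h"
      using order_trans[OF step[of l] add_right_mono[OF mult_left_mono[OF Suc]]] q1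
      unfolding h_def by simp
    also have "\<dots> \<le> q * (q ^ l * (l * h)) + q ^ Suc l * h" using h0 q1 mult_right_mono[of 1 "q ^ Suc l" h] one_le_power[of q "Suc l"] by simp
    finally show ?case unfolding h_def[symmetric] by (simp add: algebra_simps)
  qed
  from this[of k] have "expectation (\<lambda>\<omega>. S k \<omega> ^ p) \<le> q ^ k * (k * (c * k ^ (\<gamma> - 1) * K))" .
  also have "k * (c * k ^ (\<gamma> - 1) * K) = c * K * k ^ \<gamma>" using \<gamma> by (cases \<gamma>) auto
  also have "q ^ k * (c * K * k ^ \<gamma>) \<le> exp c * (c * K * k ^ \<gamma>)"
  proof (intro mult_right_mono)
    have "q ^ k \<le> exp (c / k) ^ k"
      using q1 by (intro power_mono) (auto simp: q_def)
    then show "q ^ k \<le> exp c" using False by (simp flip: exp_of_nat_mult)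
  qed (use c0 K0 in auto)
  finally show ?thesis by (simp add: S_def p_def c_def mult_ac)
qed

end

section \<open>Products of independent innovations\<close>

text \<open>
  The moments of order \<open>4 * \<gamma>\<close> of the innovations give moments of order \<open>2 * \<gamma>\<close> of their products.
\<close>

locale innovations = prob_space M for M :: "'a measure" +
  fixes e :: "int \<Rightarrow> 'a \<Rightarrow> real" and \<gamma> :: nat and K :: real
  assumes \<gamma>_pos: "\<gamma> \<ge> 1"
    and e_neg: "k < 0 \<Longrightarrow> \<omega> \<in> space M \<Longrightarrow> e k \<omega> = 0"
    and e_indep: "indep_vars (\<lambda>_. borel) e {0..}"
    and e_mean: "k \<ge> 0 \<Longrightarrow> expectation (e k) = 0"
    and e_power_integrable: "k \<ge> 0 \<Longrightarrow> integrable M (\<lambda>\<omega>. e k \<omega> ^ (4 * \<gamma>))"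
    and e_power_le: "k \<ge> 0 \<Longrightarrow> expectation (\<lambda>\<omega>. e k \<omega> ^ (4 * \<gamma>)) \<le> K"
begin

lemma e_measurable[measurable]: "random_variable borel (e k)"
proof (cases "k \<ge> 0")
  case True
  then show ?thesis using e_indep by (auto simp: indep_vars_def)
next
  case False
  then have "random_variable borel (e k) \<longleftrightarrow> random_variable borel (\<lambda>_. 0 :: real)"
    by (intro measurable_cong) (simp add: e_neg)
  then show ?thesis by simp
qed

text \<open>
  The \<open>\<sigma>\<close>-algebra generated by the innovations strictly before time \<open>t\<close>. Innovations at negative
  times vanish, so they are measurable for it as well.
\<close>

definition past :: "int \<Rightarrow> 'a measure" where
  "past t = vimage_algebra (space M) (\<lambda>\<omega>. \<lambda>s\<in>{0..<t}. e s \<omega>) (PiM {0..<t} (\<lambda>_. borel))"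

lemma space_past[simp]: "space (past t) = space M"
  by (simp add: past_def)

lemma history_measurable: "(\<lambda>\<omega>. \<lambda>s\<in>{0..<t}. e s \<omega>) \<in> M \<rightarrow>\<^sub>M PiM {0..<t} (\<lambda>_. borel)"
  by measurable

lemma sets_past: "sets (past t) =
    {(\<lambda>\<omega>. \<lambda>s\<in>{0..<t}. e s \<omega>) -` A \<inter> space M | A. A \<in> sets (PiM {0..<t} (\<lambda>_. borel))}"
  unfolding past_def using measurable_space[OF history_measurable]
  by (intro sets_vimage_algebra2) auto

lemma measurable_from_past:
  assumes "Z \<in> borel_measurable (past t)"
  shows "Z \<in> borel_measurable M"
proof (rule measurable_from_subalg[OF _ assms])
  show "subalgebra M (past t)"
    using measurable_sets[OF history_measurable] by (auto simp: subalgebra_def sets_past)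
qed

lemma e_measurable_past:
  assumes "s < t"
  shows "e s \<in> borel_measurable (past t)"
proof (cases "s \<ge> 0")
  case True
  have "(\<lambda>\<omega>. \<lambda>s\<in>{0..<t}. e s \<omega>) \<in> past t \<rightarrow>\<^sub>M PiM {0..<t} (\<lambda>_. borel)"
    unfolding past_def using measurable_space[OF history_measurable]
    by (intro measurable_vimage_algebra1) auto
  from measurable_compose[OF this measurable_component_singleton[of s]]
  show ?thesis using True assms by simp
next
  case False
  then have "e s \<in> borel_measurable (past t) \<longleftrightarrow> (\<lambda>_. 0 :: real) \<in> borel_measurable (past t)"
    by (intro measurable_cong) (simp add: e_neg)
  then show ?thesis by simp
qed

text \<open>
  Grouping the independent innovations into those before \<open>t\<close> and the one at \<open>t\<close>, and passing to
  smaller \<open>\<sigma>\<close>-algebras on both sides.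
\<close>

lemma indep_past:
  fixes Z :: "'a \<Rightarrow> real" and h :: "real \<Rightarrow> real"
  assumes "t \<ge> 0" and Z: "Z \<in> borel_measurable (past t)" and h[measurable]: "h \<in> borel_measurable borel"
  shows "indep_var borel Z borel (\<lambda>\<omega>. h (e t \<omega>))"
proof -
  let ?f = "\<lambda>\<omega>. \<lambda>s\<in>{0..<t}. e s \<omega>" and ?P = "PiM {0..<t} (\<lambda>_. borel :: real measure)"
  let ?g = "\<lambda>\<omega>. \<lambda>s\<in>{t}. e s \<omega>" and ?Q = "PiM {t} (\<lambda>_. borel :: real measure)"
  have ind: "indep_var ?P ?f ?Q ?g"
    using assms(1) by (intro indep_var_restrict[OF e_indep]) auto
  have "sigma_sets (space M) {Z -` A \<inter> space M |A. A \<in> sets borel} \<subseteq> sets (past t)"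
    unfolding space_past[symmetric, of t]
    by (rule sets.sigma_sets_subset) (use measurable_sets[OF Z] in auto)
  also have "\<dots> \<subseteq> sigma_sets (space M) {?f -` A \<inter> space M |A. A \<in> sets ?P}"
    unfolding sets_past by auto
  finally have 1: "sigma_sets (space M) {Z -` A \<inter> space M |A. A \<in> sets borel}
      \<subseteq> sigma_sets (space M) {?f -` A \<inter> space M |A. A \<in> sets ?P}" .
  have 2: "sigma_sets (space M) {(\<lambda>\<omega>. h (e t \<omega>)) -` A \<inter> space M |A. A \<in> sets borel}
      \<subseteq> sigma_sets (space M) {?g -` A \<inter> space M |A. A \<in> sets ?Q}"
  proof (intro sigma_sets_mono', safe)
    fix A :: "real set" assume A: "A \<in> sets borel"
    have "(\<lambda>v. h (v t)) \<in> borel_measurable ?Q" by measurable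
    then have "(\<lambda>v. h (v t)) -` A \<inter> space ?Q \<in> sets ?Q" using A by (rule measurable_sets)
    moreover have "(\<lambda>\<omega>. h (e t \<omega>)) -` A \<inter> space M = ?g -` ((\<lambda>v. h (v t)) -` A \<inter> space ?Q) \<inter> space M"
      by (auto simp: space_PiM)
    ultimately show "\<exists>B. (\<lambda>\<omega>. h (e t \<omega>)) -` A \<inter> space M = ?g -` B \<inter> space M \<and> B \<in> sets ?Q"
      by blast
  qed
  have "random_variable borel (\<lambda>\<omega>. h (e t \<omega>))" by measurable
  then show ?thesis
    using ind measurable_from_past[OF Z] 1 2 unfolding indep_var_eq indep_sets2_eq by blast
qed

lemma past_orthogonal:
  fixes Z :: "'a \<Rightarrow> real" and h :: "real \<Rightarrow> real"
  assumes "t \<ge> 0" and "Z \<in> borel_measurable (past t)" and "h \<in> borel_measurable borel"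
    and "integrable M Z" and "integrable M (\<lambda>\<omega>. h (e t \<omega>))"
    and "expectation (\<lambda>\<omega>. h (e t \<omega>)) = 0"
  shows "expectation (\<lambda>\<omega>. Z \<omega> * h (e t \<omega>)) = 0"
  using indep_var_lebesgue_integral[OF indep_past[OF assms(1-3)]] assms(4-6) by simp

text \<open>
  The deterministic part of a signal is treated as one more input, the constant process 1, so that
  both the deterministic and the stochastic parts of a signal are covered by one expansion.
\<close>

definition basis :: "nat \<Rightarrow> int \<Rightarrow> 'a \<Rightarrow> real" where
  "basis i l \<omega> = (case i of 0 \<Rightarrow> 1 | Suc j \<Rightarrow> e (l - int j) \<omega>)"

lemma basis_simps[simp]: "basis 0 l \<omega> = 1" "basis (Suc i) l \<omega> = e (l - int i) \<omega>"
  by (simp_all add: basis_def)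

lemma basis_measurable[measurable]: "random_variable borel (basis i l)"
  unfolding basis_def[abs_def] by (cases i) auto

lemma basis_measurable_past:
  assumes "l < t + int i - 1 \<or> i = 0"
  shows "basis i l \<in> borel_measurable (past t)"
  using assms unfolding basis_def[abs_def] by (cases i) (auto intro!: e_measurable_past)

lemma K_nonneg: "K \<ge> 0"
  by (rule order_trans[OF Bochner_Integration.integral_nonneg e_power_le[of 0]])
    (simp_all add: zero_le_even_power)

lemma e_power_integrable': "integrable M (\<lambda>\<omega>. e k \<omega> ^ (4 * \<gamma>))"
  and e_power_le': "expectation (\<lambda>\<omega>. e k \<omega> ^ (4 * \<gamma>)) \<le> K"
proof -
  have *: "integrable M (\<lambda>\<omega>. e k \<omega> ^ (4 * \<gamma>)) \<longleftrightarrow> integrable M (\<lambda>_. 0 :: real)" if "k < 0"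
    by (rule Bochner_Integration.integrable_cong) (use that \<gamma>_pos in \<open>auto simp: e_neg\<close>)
  have **: "expectation (\<lambda>\<omega>. e k \<omega> ^ (4 * \<gamma>)) = expectation (\<lambda>_. 0 :: real)" if "k < 0"
    by (rule Bochner_Integration.integral_cong) (use that \<gamma>_pos in \<open>auto simp: e_neg\<close>)
  show "integrable M (\<lambda>\<omega>. e k \<omega> ^ (4 * \<gamma>))"
    using e_power_integrable[of k] * by (cases "k \<ge> 0") auto
  show "expectation (\<lambda>\<omega>. e k \<omega> ^ (4 * \<gamma>)) \<le> K"
    using e_power_le[of k] ** K_nonneg by (cases "k \<ge> 0") auto
qed

lemma basis_power_integrable: "integrable M (\<lambda>\<omega>. basis i l \<omega> ^ (4 * \<gamma>))"
  using e_power_integrable' by (cases i) auto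

lemma basis_power_le: "expectation (\<lambda>\<omega>. basis i l \<omega> ^ (4 * \<gamma>)) \<le> 1 + K"
proof (cases i)
  case (Suc j)
  then show ?thesis using e_power_le'[of "l - int j"] by simp
qed (use K_nonneg in \<open>simp add: prob_space\<close>)

lemma basis_product_integrable:
  "integrable M (\<lambda>\<omega>. (basis i l \<omega> * basis j l \<omega>) ^ (2 * \<gamma>))"
  "integrable M (\<lambda>\<omega>. basis i l \<omega> * basis j l \<omega>)"
proof -
  show *: "integrable M (\<lambda>\<omega>. (basis i l \<omega> * basis j l \<omega>) ^ (2 * \<gamma>))"
    unfolding power_mult_distrib
    by (rule integrable_power_mult_power[where p = "4 * \<gamma>"]) (auto intro: basis_power_integrable)
  show "integrable M (\<lambda>\<omega>. basis i l \<omega> * basis j l \<omega>)"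
    using integrable_lower_power[OF _ _ _ *, of 1] \<gamma>_pos by simp
qed

lemma basis_product_power_le:
  "expectation (\<lambda>\<omega>. (basis i l \<omega> * basis j l \<omega>) ^ (2 * \<gamma>)) \<le> 2 + 2 * K"
proof -
  have "expectation (\<lambda>\<omega>. (basis i l \<omega> * basis j l \<omega>) ^ (2 * \<gamma>))
      \<le> expectation (\<lambda>\<omega>. basis i l \<omega> ^ (4 * \<gamma>) + basis j l \<omega> ^ (4 * \<gamma>))"
  proof (rule integral_mono)
    fix \<omega>
    show "(basis i l \<omega> * basis j l \<omega>) ^ (2 * \<gamma>) \<le> basis i l \<omega> ^ (4 * \<gamma>) + basis j l \<omega> ^ (4 * \<gamma>)"
      using abs_power_mult_power_le[of "2 * \<gamma>" "2 * \<gamma>" "4 * \<gamma>" "basis i l \<omega>" "basis j l \<omega>"]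
      by (simp add: power_mult_distrib power_even_abs)
  qed (auto intro: basis_power_integrable basis_product_integrable)
  also have "\<dots> \<le> 2 + 2 * K"
    using basis_power_le[of i l] basis_power_le[of j l] by (simp add: basis_power_integrable)
  finally show ?thesis .
qed

definition centred_product :: "nat \<Rightarrow> nat \<Rightarrow> int \<Rightarrow> 'a \<Rightarrow> real" where
  "centred_product i j l \<omega> = basis i l \<omega> * basis j l \<omega> - expectation (\<lambda>\<omega>. basis i l \<omega> * basis j l \<omega>)"

lemma centred_product_measurable[measurable]: "random_variable borel (centred_product i j l)"
  unfolding centred_product_def[abs_def] by measurable

lemma centred_product_commute: "centred_product i j = centred_product j i"
  by (intro ext) (simp add: centred_product_def mult.commute)

lemma centred_product_power_integrable: "integrable M (\<lambda>\<omega>. centred_product i j l \<omega> ^ (2 * \<gamma>))"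
  unfolding centred_product_def diff_conv_add_uminus
  by (rule integrable_power_add) (auto simp: basis_product_integrable)

definition centred_bound :: real where
  "centred_bound = 2 ^ (2 * \<gamma>) * ((2 + 2 * K) + (3 + 2 * K) ^ (2 * \<gamma>))"

lemma centred_product_power_le:
  "expectation (\<lambda>\<omega>. centred_product i j l \<omega> ^ (2 * \<gamma>)) \<le> centred_bound"
proof -
  let ?P = "\<lambda>\<omega>. basis i l \<omega> * basis j l \<omega>"
  have "expectation (\<lambda>\<omega>. centred_product i j l \<omega> ^ (2 * \<gamma>))
      \<le> expectation (\<lambda>\<omega>. 2 ^ (2 * \<gamma>) * (?P \<omega> ^ (2 * \<gamma>) + (expectation ?P) ^ (2 * \<gamma>)))"
  proof (rule integral_mono)
    fix \<omega>
    show "centred_product i j l \<omega> ^ (2 * \<gamma>) \<le> 2 ^ (2 * \<gamma>) * (?P \<omega> ^ (2 * \<gamma>) + (expectation ?P) ^ (2 * \<gamma>))"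
      using power_add_le_even[of "2 * \<gamma>" "?P \<omega>" "- expectation ?P"]
      by (simp add: centred_product_def)
  qed (auto simp: basis_product_integrable centred_product_power_integrable)
  also have "\<dots> = 2 ^ (2 * \<gamma>) * (expectation (\<lambda>\<omega>. ?P \<omega> ^ (2 * \<gamma>)) + (expectation ?P) ^ (2 * \<gamma>))"
    by (simp add: basis_product_integrable prob_space)
  also have "\<dots> \<le> centred_bound"
    unfolding centred_bound_def
  proof (intro mult_left_mono add_mono basis_product_power_le)
    have "\<bar>expectation ?P\<bar> \<le> 3 + 2 * K"
      using abs_expectation_le[of ?P "2 * \<gamma>"] basis_product_power_le[of i l j] \<gamma>_pos
      by (simp add: basis_product_integrable)
    then have "\<bar>expectation ?P\<bar> ^ (2 * \<gamma>) \<le> (3 + 2 * K) ^ (2 * \<gamma>)" by (intro power_mono) auto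
    then show "(expectation ?P) ^ (2 * \<gamma>) \<le> (3 + 2 * K) ^ (2 * \<gamma>)" by (simp add: power_even_abs)
  qed auto
  finally show ?thesis .
qed

lemma e_integrable: "integrable M (e k)"
  using integrable_lower_power[OF _ _ _ e_power_integrable', of 1] \<gamma>_pos by simp

lemma e_square_integrable: "integrable M (\<lambda>\<omega>. (e k \<omega>)\<^sup>2)"
  using integrable_lower_power[OF _ _ _ e_power_integrable', of 2] \<gamma>_pos by simp


text \<open>
  Unless both indices are 0, a centred product is a factor known before the time \<open>t\<close> of its most recent innovation, times a
  centred function of \<open>e t\<close>, and \<open>e t\<close> is independent of everything before \<open>t\<close>. The index 0 stands
  for the constant, hence the case distinction on which index carries that innovation.
\<close>

lemma centred_product_orthogonal:
  assumes ij: "i \<le> j"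
    and S: "S \<in> borel_measurable (past (l + 1 - int (if i = 0 then j else i)))"
    and int: "integrable M (\<lambda>\<omega>. S \<omega> ^ (2 * \<gamma>))"
  shows "expectation (\<lambda>\<omega>. S \<omega> ^ (2 * \<gamma> - 1) * centred_product i j l \<omega>) = 0"
proof (cases "j = 0")
  case True
  then show ?thesis using ij by (simp add: centred_product_def prob_space)
next
  case False
  define t where "t = l + 1 - int (if i = 0 then j else i)"
  have S': "S \<in> borel_measurable (past t)" using S by (simp add: t_def)
  note [measurable] = measurable_from_past[OF S']
  have intS: "integrable M (\<lambda>\<omega>. S \<omega> ^ (2 * \<gamma> - 1))"
    using integrable_lower_power[OF _ _ _ int, of "2 * \<gamma> - 1"] by simp
  have Sp: "(\<lambda>\<omega>. S \<omega> ^ (2 * \<gamma> - 1)) \<in> borel_measurable (past t)" using S' by measurable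
  show ?thesis
  proof (cases "t < 0")
    case True
    then have zero: "basis i l \<omega> * basis j l \<omega> = 0" if "\<omega> \<in> space M" for \<omega>
      using False that
      by (cases i; cases j) (auto simp: t_def intro!: e_neg)
    have E: "expectation (\<lambda>\<omega>. basis i l \<omega> * basis j l \<omega>) = expectation (\<lambda>_. 0)"
      by (intro Bochner_Integration.integral_cong) (use zero in auto)
    have "expectation (\<lambda>\<omega>. S \<omega> ^ (2 * \<gamma> - 1) * centred_product i j l \<omega>) = expectation (\<lambda>_. 0)"
      by (intro Bochner_Integration.integral_cong refl)
        (simp add: centred_product_def zero E)
    then show ?thesis by simp
  next
    case t: False
    consider (zero) j' where "i = 0" "j = Suc j'" | (eq) i' where "i = Suc i'" "j = i"
      | (less) i' j' where "i = Suc i'" "j = Suc j'" "i' < j'"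
      using ij False by (cases i; cases j) force+
    then show ?thesis
    proof cases
      case zero
      then have [simp]: "l - int j' = t" by (simp add: t_def)
      show ?thesis
        using past_orthogonal[of t "\<lambda>\<omega>. S \<omega> ^ (2 * \<gamma> - 1)" "\<lambda>x. x - expectation (e t)"] t zero
          intS Sp e_integrable
        by (simp add: centred_product_def prob_space)
    next
      case eq
      then have [simp]: "l - int i' = t" by (simp add: t_def)
      show ?thesis
        using past_orthogonal[of t "\<lambda>\<omega>. S \<omega> ^ (2 * \<gamma> - 1)" "\<lambda>x. x\<^sup>2 - expectation (\<lambda>\<omega>. (e t \<omega>)\<^sup>2)"] t eq
          intS Sp e_square_integrable
        by (simp add: centred_product_def prob_space power2_eq_square)
    next
      case less
      define s where "s = l - int j'"
      have st: "s < t" "l - int i' = t" using less by (auto simp: t_def s_def)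
      have "expectation (\<lambda>\<omega>. e s \<omega> * e t \<omega>) = 0"
        using past_orthogonal[of t "e s" "\<lambda>x. x"] t st e_integrable e_mean
        by (simp add: e_measurable_past)
      moreover have "expectation (\<lambda>\<omega>. (S \<omega> ^ (2 * \<gamma> - 1) * e s \<omega>) * e t \<omega>) = 0"
      proof (rule past_orthogonal[where h = "\<lambda>x. x"])
        show "(\<lambda>\<omega>. S \<omega> ^ (2 * \<gamma> - 1) * e s \<omega>) \<in> borel_measurable (past t)"
          using S' e_measurable_past[OF st(1)] by measurable
        have "integrable M (\<lambda>\<omega>. e s \<omega> ^ (2 * \<gamma>))"
          using integrable_lower_power[OF _ _ _ e_power_integrable', of "2 * \<gamma>"] by simp
        then show "integrable M (\<lambda>\<omega>. S \<omega> ^ (2 * \<gamma> - 1) * e s \<omega>)"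
          using integrable_power_mult_power[of "2 * \<gamma> - 1" 1 "2 * \<gamma>" S "e s"] int \<gamma>_pos by simp
      qed (use t e_integrable e_mean in auto)
      ultimately show ?thesis
        using less st by (simp add: centred_product_def s_def mult_ac)
    qed
  qed
qed

text \<open>
  The bound is uniform in the two delays and in the bounded coefficients. This uniformity is what
  allows the summation over all pairs of delays in a product of two filtered signals.
\<close>

lemma centred_product_sum_moment_bound:
  assumes c: "\<And>l. \<bar>c l\<bar> \<le> 1"
  shows "expectation (\<lambda>\<omega>. (\<Sum>l<k. c l * centred_product i j (int l + 1) \<omega>) ^ (2 * \<gamma>))
           \<le> 4 ^ \<gamma> * exp (4 ^ \<gamma>) * centred_bound * k ^ \<gamma>"
proof (induction i j rule: linorder_wlog)
  case (sym i j)
  then show ?case by (simp add: centred_product_commute[of j i])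
next
  case (le i j)
  let ?X = "\<lambda>l \<omega>. c l * centred_product i j (int l + 1) \<omega>"
  have int: "integrable M (\<lambda>\<omega>. ?X l \<omega> ^ (2 * \<gamma>))" for l
    unfolding power_mult_distrib by (simp add: centred_product_power_integrable)
  show ?case
  proof (rule orthogonal_increments_moment_bound[OF \<gamma>_pos _ int])
    fix l :: nat
    have "\<bar>c l\<bar> ^ (2 * \<gamma>) \<le> 1" using c[of l] by (intro power_le_one) auto
    then have "c l ^ (2 * \<gamma>) \<le> 1" by (simp add: power_even_abs)
    moreover have "0 \<le> expectation (\<lambda>\<omega>. centred_product i j (int l + 1) \<omega> ^ (2 * \<gamma>))"
      by (intro Bochner_Integration.integral_nonneg) (simp add: zero_le_even_power)
    ultimately show "expectation (\<lambda>\<omega>. ?X l \<omega> ^ (2 * \<gamma>)) \<le> centred_bound"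
      using centred_product_power_le[of i j "int l + 1"]
        mult_right_mono[of "c l ^ (2 * \<gamma>)" 1 "expectation (\<lambda>\<omega>. centred_product i j (int l + 1) \<omega> ^ (2 * \<gamma>))"]
      by (simp add: power_mult_distrib)
    define t where "t = int l + 2 - int (if i = 0 then j else i)"
    define S where "S = (\<lambda>\<omega>. \<Sum>l'<l. ?X l' \<omega>)"
    have "?X l' \<in> borel_measurable (past t)" if "l' < l" for l'
    proof -
      have "basis i (int l' + 1) \<in> borel_measurable (past t)"
        "basis j (int l' + 1) \<in> borel_measurable (past t)"
        using that le by (auto intro!: basis_measurable_past simp: t_def)
      then show ?thesis unfolding centred_product_def by measurable
    qed
    then have "S \<in> borel_measurable (past t)" unfolding S_def by (intro borel_measurable_sum) auto
    moreover have "integrable M (\<lambda>\<omega>. S \<omega> ^ (2 * \<gamma>))"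
      unfolding S_def using \<gamma>_pos int by (intro integrable_power_sum) auto
    ultimately have "expectation (\<lambda>\<omega>. S \<omega> ^ (2 * \<gamma> - 1) * centred_product i j (int l + 1) \<omega>) = 0"
      using le by (intro centred_product_orthogonal) (auto simp: t_def algebra_simps)
    then have "expectation (\<lambda>\<omega>. c l * (S \<omega> ^ (2 * \<gamma> - 1) * centred_product i j (int l + 1) \<omega>)) = 0"
      by simp
    then show "expectation (\<lambda>\<omega>. (\<Sum>j<l. ?X j \<omega>) ^ (2 * \<gamma> - 1) * ?X l \<omega>) = 0"
      by (simp add: S_def mult_ac)
  qed measurable
qed

end

section \<open>Stable filters of the innovations\<close>

context innovations
begin

text \<open>
  The signals that are uniformly stable time-varying filters of the innovations plus a bounded
  deterministic part. The series is cut off at any \<open>N\<close> beyond the present time, which loses nothing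
  because innovations at negative times vanish and keeps all sums finite; the freedom in \<open>N\<close> lets
  several times and several signals share one index set.
\<close>

definition lin_filter :: "(int \<Rightarrow> 'a \<Rightarrow> real) \<Rightarrow> bool" where
  "lin_filter w \<longleftrightarrow> (\<exists>F G. summable G \<and> (\<forall>i l. \<bar>F i l\<bar> \<le> G i) \<and>
     (\<forall>l N. l < int N \<longrightarrow> (AE \<omega> in M. w l \<omega> = (\<Sum>i\<le>N. F i l * basis i l \<omega>))))"

lemma lin_filter_add:
  assumes "lin_filter w" "lin_filter z"
  shows "lin_filter (\<lambda>l \<omega>. w l \<omega> + z l \<omega>)"
proof -
  obtain F G where F: "summable G" "\<And>i l. \<bar>F i l\<bar> \<le> G i"
    "\<And>l N. l < int N \<Longrightarrow> (AE \<omega> in M. w l \<omega> = (\<Sum>i\<le>N. F i l * basis i l \<omega>))"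
    using assms(1) unfolding lin_filter_def by blast
  obtain F' G' where F': "summable G'" "\<And>i l. \<bar>F' i l\<bar> \<le> G' i"
    "\<And>l N. l < int N \<Longrightarrow> (AE \<omega> in M. z l \<omega> = (\<Sum>i\<le>N. F' i l * basis i l \<omega>))"
    using assms(2) unfolding lin_filter_def by blast
  have "\<bar>F i l + F' i l\<bar> \<le> G i + G' i" for i l using F(2)[of i l] F'(2)[of i l] by linarith
  moreover have "AE \<omega> in M. w l \<omega> + z l \<omega> = (\<Sum>i\<le>N. (F i l + F' i l) * basis i l \<omega>)"
    if "l < int N" for l N
    using F(3)[OF that] F'(3)[OF that] by eventually_elim (simp add: distrib_right sum.distrib)
  ultimately show ?thesis
    unfolding lin_filter_def using summable_add[OF F(1) F'(1)] by fast
qed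

lemma lin_filter_scale:
  assumes "lin_filter w"
  shows "lin_filter (\<lambda>l \<omega>. c * w l \<omega>)"
proof -
  obtain F G where F: "summable G" "\<And>i l. \<bar>F i l\<bar> \<le> G i"
    "\<And>l N. l < int N \<Longrightarrow> (AE \<omega> in M. w l \<omega> = (\<Sum>i\<le>N. F i l * basis i l \<omega>))"
    using assms(1) unfolding lin_filter_def by blast
  have "\<bar>c * F i l\<bar> \<le> \<bar>c\<bar> * G i" for i l using F(2)[of i l] by (simp add: abs_mult mult_left_mono)
  moreover have "AE \<omega> in M. c * w l \<omega> = (\<Sum>i\<le>N. (c * F i l) * basis i l \<omega>)"
    if "l < int N" for l N
    using F(3)[OF that] by eventually_elim (simp add: sum_distrib_left mult_ac)
  ultimately show ?thesis
    unfolding lin_filter_def using summable_mult[OF F(1), of "\<bar>c\<bar>"] by fast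
qed

lemma lin_filter_zero: "lin_filter (\<lambda>l \<omega>. 0)"
  unfolding lin_filter_def by (intro exI[of _ "\<lambda>_ _. 0"] exI[of _ "\<lambda>_. 0"]) auto

lemma lin_filter_sum:
  assumes "\<And>i. i \<in> I \<Longrightarrow> lin_filter (w i)"
  shows "lin_filter (\<lambda>l \<omega>. \<Sum>i\<in>I. w i l \<omega>)"
  using assms
  by (induction I rule: infinite_finite_induct) (auto intro: lin_filter_zero lin_filter_add)

lemma lin_filter_uminus: "lin_filter w \<Longrightarrow> lin_filter (\<lambda>l \<omega>. - w l \<omega>)"
  using lin_filter_scale[of w "-1"] by simp

lemma lin_filter_diff: "lin_filter w \<Longrightarrow> lin_filter z \<Longrightarrow> lin_filter (\<lambda>l \<omega>. w l \<omega> - z l \<omega>)"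
  using lin_filter_add[OF _ lin_filter_uminus] by fastforce

text \<open>
  A delay moves each innovation coefficient up by one index and leaves the constant part in place, so
  the coefficient with index 1, that of the present innovation, becomes 0.
\<close>

lemma lin_filter_delay1:
  assumes "lin_filter w"
  shows "lin_filter (\<lambda>l. w (l - 1))"
proof -
  obtain F G where F: "summable G" "\<And>i l. \<bar>F i l\<bar> \<le> G i"
    "\<And>l N. l < int N \<Longrightarrow> (AE \<omega> in M. w l \<omega> = (\<Sum>i\<le>N. F i l * basis i l \<omega>))"
    using assms(1) unfolding lin_filter_def by blast
  define F' where "F' i l = (case i of 0 \<Rightarrow> F 0 (l - 1) | Suc 0 \<Rightarrow> 0 | Suc (Suc j) \<Rightarrow> F (Suc j) (l - 1))" for i l
  define G' where "G' i = (case i of 0 \<Rightarrow> G 0 | Suc 0 \<Rightarrow> 0 | Suc (Suc j) \<Rightarrow> G (Suc j))" for i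
  have "summable (\<lambda>i. G' (Suc (Suc i)))"
    using F(1) unfolding G'_def by (simp add: summable_Suc_iff)
  then have "summable G'"
    using summable_Suc_iff[of "\<lambda>i. G' (Suc i)"] summable_Suc_iff[of G'] by blast
  moreover have "\<bar>F' i l\<bar> \<le> G' i" for i l
    using F(2) by (auto simp: F'_def G'_def split: nat.split)
  moreover have "AE \<omega> in M. w (l - 1) \<omega> = (\<Sum>i\<le>N. F' i l * basis i l \<omega>)" if l: "l < int N" for l N
  proof (cases N)
    case 0
    then have "AE \<omega> in M. w (l - 1) \<omega> = (\<Sum>i\<le>0. F i (l - 1) * basis i (l - 1) \<omega>)"
      using l by (intro F(3)) auto
    then show ?thesis using 0 by (simp add: F'_def)
  next
    case (Suc N')
    then have "AE \<omega> in M. w (l - 1) \<omega> = (\<Sum>i\<le>N'. F i (l - 1) * basis i (l - 1) \<omega>)"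
      using l by (intro F(3)) auto
    moreover have "(\<Sum>i\<le>N'. F i (l - 1) * basis i (l - 1) \<omega>) = (\<Sum>i\<le>N. F' i l * basis i l \<omega>)" for \<omega>
    proof (cases N')
      case 0
      then show ?thesis using Suc by (simp add: F'_def)
    next
      case (Suc N'')
      have "(\<Sum>i\<le>N. F' i l * basis i l \<omega>)
          = F 0 (l - 1) + (\<Sum>i\<le>N''. F (Suc i) (l - 1) * e (l - int (Suc i)) \<omega>)"
        unfolding \<open>N = Suc N'\<close> Suc sum.atMost_Suc_shift by (simp add: F'_def)
      also have "\<dots> = (\<Sum>i\<le>N'. F i (l - 1) * basis i (l - 1) \<omega>)"
        unfolding Suc sum.atMost_Suc_shift by (simp add: algebra_simps)
      finally show ?thesis by simp
    qed
    ultimately show ?thesis by simp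
  qed
  ultimately show ?thesis unfolding lin_filter_def by blast
qed

lemma lin_filter_delay:
  assumes "lin_filter w"
  shows "lin_filter (\<lambda>l. w (l - int i))"
proof (induction i)
  case (Suc i)
  then show ?case using lin_filter_delay1[OF Suc] by (simp add: algebra_simps)
qed (use assms in simp)

text \<open>
  Jensen's inequality with the summable coefficient bounds as weights.
\<close>

lemma lin_filter_power_bound:
  assumes "lin_filter w" and w[measurable]: "\<And>l. random_variable borel (w l)"
  shows "\<exists>C. \<forall>l. integrable M (\<lambda>\<omega>. w l \<omega> ^ (4 * \<gamma>)) \<and> expectation (\<lambda>\<omega>. w l \<omega> ^ (4 * \<gamma>)) \<le> C"
proof -
  define p where "p = 4 * \<gamma>"
  have p: "even p" "p > 0" using \<gamma>_pos by (auto simp: p_def)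
  obtain F G where F: "summable G" "\<And>i l. \<bar>F i l\<bar> \<le> G i"
    "\<And>l N. l < int N \<Longrightarrow> (AE \<omega> in M. w l \<omega> = (\<Sum>i\<le>N. F i l * basis i l \<omega>))"
    using assms(1) unfolding lin_filter_def by blast
  have G0: "G i \<ge> 0" for i using F(2)[of i 0] by linarith
  have "integrable M (\<lambda>\<omega>. w l \<omega> ^ p) \<and> expectation (\<lambda>\<omega>. w l \<omega> ^ p) \<le> suminf G ^ p * (1 + K)" for l
  proof -
    define N where "N = nat l + 1"
    have lN: "l < int N" by (simp add: N_def)
    define R where "R \<omega> = (\<Sum>i\<le>N. G i) ^ (p - 1) * (\<Sum>i\<le>N. G i * basis i l \<omega> ^ p)" for \<omega>
    have ae: "AE \<omega> in M. w l \<omega> ^ p \<le> R \<omega>"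
      using F(3)[OF lN]
    proof eventually_elim
      case (elim \<omega>)
      have "\<bar>w l \<omega>\<bar> \<le> (\<Sum>i\<le>N. G i * \<bar>basis i l \<omega>\<bar>)"
        using elim F(2) by (auto simp: abs_mult intro!: order_trans[OF sum_abs] sum_mono mult_right_mono)
      then have "\<bar>w l \<omega>\<bar> ^ p \<le> (\<Sum>i\<le>N. G i * \<bar>basis i l \<omega>\<bar>) ^ p"
        by (intro power_mono) auto
      also have "\<dots> \<le> (\<Sum>i\<le>N. G i) ^ (p - 1) * (\<Sum>i\<le>N. G i * \<bar>basis i l \<omega>\<bar> ^ p)"
        using p G0 by (intro weighted_sum_power_le) auto
      finally show ?case using p by (simp add: R_def power_even_abs)
    qed
    have R: "integrable M R" unfolding R_def p_def by (intro integrable_mult_right Bochner_Integration.integrable_sum basis_power_integrable)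
    have int: "integrable M (\<lambda>\<omega>. w l \<omega> ^ p)"
    proof (rule Bochner_Integration.integrable_bound[OF R])
      show "AE \<omega> in M. norm (w l \<omega> ^ p) \<le> norm (R \<omega>)"
        using ae p by (auto simp: zero_le_even_power)
    qed measurable
    have "expectation (\<lambda>\<omega>. w l \<omega> ^ p) \<le> expectation R"
      by (rule integral_mono_AE[OF int R ae])
    also have "\<dots> = (\<Sum>i\<le>N. G i) ^ (p - 1) * (\<Sum>i\<le>N. G i * expectation (\<lambda>\<omega>. basis i l \<omega> ^ p))"
      unfolding R_def p_def by (simp add: basis_power_integrable)
    also have "\<dots> \<le> (\<Sum>i\<le>N. G i) ^ (p - 1) * (\<Sum>i\<le>N. G i * (1 + K))"
      using basis_power_le G0 p unfolding p_def
      by (intro mult_left_mono sum_mono) (auto simp: sum_nonneg)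
    also have "\<dots> = (\<Sum>i\<le>N. G i) ^ p * (1 + K)"
      using p by (cases p) (auto simp flip: sum_distrib_right)
    also have "\<dots> \<le> suminf G ^ p * (1 + K)"
      using K_nonneg G0 F(1) by (intro mult_right_mono power_mono sum_le_suminf) (auto simp: sum_nonneg)
    finally show ?thesis using int by simp
  qed
  then show ?thesis unfolding p_def by blast
qed

lemma lin_filter_product_integrable:
  assumes "lin_filter w" "lin_filter z"
    and "\<And>l. random_variable borel (w l)" "\<And>l. random_variable borel (z l)"
  shows "integrable M (\<lambda>\<omega>. (w l \<omega> * z l \<omega>) ^ (2 * \<gamma>))" "integrable M (\<lambda>\<omega>. w l \<omega> * z l \<omega>)"
proof -
  note [measurable] = assms(3,4)
  show *: "integrable M (\<lambda>\<omega>. (w l \<omega> * z l \<omega>) ^ (2 * \<gamma>))"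
    unfolding power_mult_distrib
    using lin_filter_power_bound[OF assms(1,3)] lin_filter_power_bound[OF assms(2,4)]
    by (intro integrable_power_mult_power[where p = "4 * \<gamma>"]) auto
  show "integrable M (\<lambda>\<omega>. w l \<omega> * z l \<omega>)"
    using integrable_lower_power[OF _ _ _ *, of 1] \<gamma>_pos by simp
qed

text \<open>
  Expanding both signals turns the sum over time into a combination, with summable weights
  \<open>G i * G' j\<close>, of sums of centred products with coefficients bounded by 1. Jensen's inequality
  over the pairs \<open>(i, j)\<close> passes the uniform bound on the latter to the combination.
\<close>

lemma lin_filter_centred_sum_bound:
  assumes "lin_filter w" "lin_filter z"
    and "\<And>l. random_variable borel (w l)" "\<And>l. random_variable borel (z l)"
  shows "\<exists>C :: real. C \<ge> 0 \<and> (\<forall>k. expectation (\<lambda>\<omega>. (\<Sum>l<k. w (int l + 1) \<omega> * z (int l + 1) \<omega>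
            - expectation (\<lambda>\<omega>. w (int l + 1) \<omega> * z (int l + 1) \<omega>)) ^ (2 * \<gamma>)) \<le> C * real k ^ \<gamma>)"
proof -
  note [measurable] = assms(3,4)
  define p where "p = 2 * \<gamma>"
  have p: "even p" "p > 0" using \<gamma>_pos by (auto simp: p_def)
  obtain F G where F: "summable G" "\<And>i l. \<bar>F i l\<bar> \<le> G i"
    "\<And>l N. l < int N \<Longrightarrow> (AE \<omega> in M. w l \<omega> = (\<Sum>i\<le>N. F i l * basis i l \<omega>))"
    using assms(1) unfolding lin_filter_def by blast
  obtain F' G' where F': "summable G'" "\<And>i l. \<bar>F' i l\<bar> \<le> G' i"
    "\<And>l N. l < int N \<Longrightarrow> (AE \<omega> in M. z l \<omega> = (\<Sum>i\<le>N. F' i l * basis i l \<omega>))"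
    using assms(2) unfolding lin_filter_def by blast
  have G0: "G i \<ge> 0" for i using F(2)[of i 0] by linarith
  have G0': "G' i \<ge> 0" for i using F'(2)[of i 0] by linarith
  define C0 where "C0 = 4 ^ \<gamma> * exp (4 ^ \<gamma>) * centred_bound"
  have C0: "C0 \<ge> 0" using K_nonneg by (simp add: C0_def centred_bound_def)
  define T where "T k \<omega> = (\<Sum>l<k. w (int l + 1) \<omega> * z (int l + 1) \<omega>
            - expectation (\<lambda>\<omega>. w (int l + 1) \<omega> * z (int l + 1) \<omega>))" for k \<omega>
  have "expectation (\<lambda>\<omega>. T k \<omega> ^ p) \<le> (suminf G * suminf G') ^ p * C0 * real k ^ \<gamma>" for k
  proof -
    define N where "N = k + 1"
    define I where "I = {..N} \<times> {..N}"
    define g where "g = (\<lambda>(i, j). G i * G' j)"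
    \<comment> \<open>If g (i, j) = 0, the numerator vanishes as well and c is 0, in accordance with gc below.\<close>
    define c where "c = (\<lambda>(i, j) l. F i (int l + 1) * F' j (int l + 1) / g (i, j))"
    define Z where "Z = (\<lambda>(i, j) \<omega>. \<Sum>l<k. c (i, j) l * centred_product i j (int l + 1) \<omega>)"
    have g0: "g q \<ge> 0" for q using G0 G0' by (auto simp: g_def split: prod.split)
    have FF: "\<bar>F i l * F' j l\<bar> \<le> g (i, j)" for i j l
      using F(2)[of i l] F'(2)[of j l] G0 G0' by (auto simp: g_def abs_mult intro!: mult_mono)
    have c1: "\<bar>c q l\<bar> \<le> 1" for q l
      using FF[of "fst q" "int l + 1" "snd q"] g0[of q]
      by (cases q) (auto simp: c_def divide_le_eq_1)
    have gc: "g (i, j) * c (i, j) l = F i (int l + 1) * F' j (int l + 1)" for i j l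
      using FF[of i "int l + 1" j] by (auto simp: c_def)
    have prod_eq: "AE \<omega> in M. w (int l + 1) \<omega> * z (int l + 1) \<omega>
        = (\<Sum>(i, j)\<in>I. F i (int l + 1) * F' j (int l + 1) * (basis i (int l + 1) \<omega> * basis j (int l + 1) \<omega>))"
      if "l < k" for l
    proof -
      have "int l + 1 < int N" using that by (simp add: N_def)
      from F(3)[OF this] F'(3)[OF this] show ?thesis
        by eventually_elim
          (simp only: I_def sum_product sum.cartesian_product case_prod_beta mult.assoc mult.left_commute)
    qed
    have centred_eq: "AE \<omega> in M. w (int l + 1) \<omega> * z (int l + 1) \<omega>
            - expectation (\<lambda>\<omega>. w (int l + 1) \<omega> * z (int l + 1) \<omega>)
        = (\<Sum>(i, j)\<in>I. F i (int l + 1) * F' j (int l + 1) * centred_product i j (int l + 1) \<omega>)"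
      if "l < k" for l
    proof -
      have "expectation (\<lambda>\<omega>. w (int l + 1) \<omega> * z (int l + 1) \<omega>)
          = expectation (\<lambda>\<omega>. \<Sum>(i, j)\<in>I. F i (int l + 1) * F' j (int l + 1) *
              (basis i (int l + 1) \<omega> * basis j (int l + 1) \<omega>))"
        by (rule integral_cong_AE) (use prod_eq[OF that] in \<open>auto simp: case_prod_beta\<close>)
      also have "\<dots> = (\<Sum>(i, j)\<in>I. F i (int l + 1) * F' j (int l + 1) *
              expectation (\<lambda>\<omega>. basis i (int l + 1) \<omega> * basis j (int l + 1) \<omega>))"
        by (simp add: case_prod_beta basis_product_integrable)
      finally have E: "expectation (\<lambda>\<omega>. w (int l + 1) \<omega> * z (int l + 1) \<omega>) = \<dots>" .
      show ?thesis
        using prod_eq[OF that]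
        by eventually_elim
          (simp add: E centred_product_def case_prod_beta right_diff_distrib sum_subtractf)
    qed
    have "AE \<omega> in M. \<forall>l\<in>{..<k}. w (int l + 1) \<omega> * z (int l + 1) \<omega>
            - expectation (\<lambda>\<omega>. w (int l + 1) \<omega> * z (int l + 1) \<omega>)
        = (\<Sum>(i, j)\<in>I. F i (int l + 1) * F' j (int l + 1) * centred_product i j (int l + 1) \<omega>)"
      using centred_eq by (intro AE_finite_allI) auto
    then have T: "AE \<omega> in M. T k \<omega> = (\<Sum>q\<in>I. g q * Z q \<omega>)"
    proof eventually_elim
      case (elim \<omega>)
      have "T k \<omega> = (\<Sum>l<k. \<Sum>(i, j)\<in>I. g (i, j) * (c (i, j) l * centred_product i j (int l + 1) \<omega>))"
        unfolding T_def using elim by (intro sum.cong refl) (simp add: gc flip: mult.assoc)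
      also have "\<dots> = (\<Sum>(i, j)\<in>I. \<Sum>l<k. g (i, j) * (c (i, j) l * centred_product i j (int l + 1) \<omega>))"
        by (subst sum.swap) (simp add: case_prod_beta)
      finally show ?case by (simp add: Z_def case_prod_beta sum_distrib_left)
    qed
    define R where "R \<omega> = (\<Sum>q\<in>I. g q) ^ (p - 1) * (\<Sum>q\<in>I. g q * Z q \<omega> ^ p)" for \<omega>
    have ae: "AE \<omega> in M. T k \<omega> ^ p \<le> R \<omega>"
      using T
    proof eventually_elim
      case (elim \<omega>)
      then show ?case unfolding R_def using p g0
        by (simp only:) (intro weighted_sum_power_le, auto simp: I_def)
    qed
    have [measurable]: "random_variable borel (Z q)" for q
      unfolding Z_def by (cases q) simp
    have intZ: "integrable M (\<lambda>\<omega>. Z q \<omega> ^ p)" for q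
      unfolding Z_def using p
      by (cases q) (auto intro!: integrable_power_sum simp: power_mult_distrib p_def centred_product_power_integrable)
    have EZ: "expectation (\<lambda>\<omega>. Z q \<omega> ^ p) \<le> C0 * real k ^ \<gamma>" for q
      using centred_product_sum_moment_bound[of "c q" "fst q" "snd q" k] c1[of q]
      by (cases q) (simp add: Z_def p_def C0_def)
    have R: "integrable M R" unfolding R_def by (intro integrable_mult_right Bochner_Integration.integrable_sum intZ)
    have int: "integrable M (\<lambda>\<omega>. T k \<omega> ^ p)"
    proof (rule Bochner_Integration.integrable_bound[OF R])
      show "AE \<omega> in M. norm (T k \<omega> ^ p) \<le> norm (R \<omega>)"
        using ae p by (auto simp: zero_le_even_power)
    qed (simp add: T_def)
    have "expectation (\<lambda>\<omega>. T k \<omega> ^ p) \<le> expectation R"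
      by (rule integral_mono_AE[OF int R ae])
    also have "\<dots> = sum g I ^ (p - 1) * (\<Sum>q\<in>I. g q * expectation (\<lambda>\<omega>. Z q \<omega> ^ p))"
      unfolding R_def by (simp add: intZ)
    also have "\<dots> \<le> sum g I ^ (p - 1) * (\<Sum>q\<in>I. g q * (C0 * real k ^ \<gamma>))"
      using EZ g0 by (intro mult_left_mono sum_mono) (auto simp: sum_nonneg)
    also have "\<dots> = sum g I ^ p * (C0 * real k ^ \<gamma>)"
      using p by (cases p) (auto simp flip: sum_distrib_right)
    also have "sum g I = sum G {..N} * sum G' {..N}"
      by (simp add: I_def g_def sum_product sum.cartesian_product)
    also have "(sum G {..N} * sum G' {..N}) ^ p * (C0 * real k ^ \<gamma>) \<le> (suminf G * suminf G') ^ p * (C0 * real k ^ \<gamma>)"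
      using C0 G0 G0' F(1) F'(1)
      by (intro mult_right_mono power_mono mult_mono sum_le_suminf) (auto simp: sum_nonneg suminf_nonneg)
    finally show ?thesis by (simp add: mult.assoc)
  qed
  moreover have "(suminf G * suminf G') ^ p * C0 \<ge> 0" using p C0 by (simp add: zero_le_even_power)
  ultimately show ?thesis unfolding T_def p_def by blast
qed

end

section \<open>Recursive least squares along a trajectory\<close>

text \<open>
  The operator inverse to \<open>rls_P \<phi> P0 k\<close> when \<open>L\<close> is inverse to \<open>P0\<close>.
\<close>

definition information :: "(real ^ 'd \<Rightarrow> real ^ 'd) \<Rightarrow> (nat \<Rightarrow> real ^ 'd) \<Rightarrow> nat \<Rightarrow> real ^ 'd \<Rightarrow> real ^ 'd" where
  "information L \<phi> k x = L x + (\<Sum>l<k. (\<phi> (Suc l) \<bullet> x) *\<^sub>R \<phi> (Suc l))"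

lemma outer_product_mult_vector:
  fixes v w x :: "real ^ 'd"
  shows "outer_product v w *v x = (w \<bullet> x) *\<^sub>R v"
  by (simp add: vec_eq_iff outer_product_def matrix_vector_mult_def inner_vec_def sum_distrib_left mult_ac)

lemma rls_P_Suc_mult_vector:
  fixes P0 :: "real ^ 'd ^ 'd"
  shows "rls_P \<phi> P0 (Suc k) *v x = rls_P \<phi> P0 k *v x
      - (inverse (1 + \<phi> (Suc k) \<bullet> (rls_P \<phi> P0 k *v \<phi> (Suc k))) * (\<phi> (Suc k) \<bullet> (rls_P \<phi> P0 k *v x)))
          *\<^sub>R (rls_P \<phi> P0 k *v \<phi> (Suc k))"
  by (simp add: Let_def matrix_vector_mult_diff_rdistrib matrix_vector_mul_assoc[symmetric]
      scaleR_matrix_vector_assoc[symmetric] outer_product_mult_vector matrix_vector_mult_scaleR)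

text \<open>
  The map \<open>L\<close> stands for the inverse of \<open>P0\<close>, so that its coercivity expresses positive definiteness.
\<close>

locale rls_run =
  fixes \<phi> :: "nat \<Rightarrow> real ^ 'd" and P0 :: "real ^ 'd ^ 'd"
    and L :: "real ^ 'd \<Rightarrow> real ^ 'd" and c :: real
  assumes linear_L: "linear L" and L_P0: "L (P0 *v x) = x"
    and c_pos: "c > 0" and L_coercive: "x \<bullet> L x \<ge> c * (norm x)\<^sup>2"
begin

abbreviation P :: "nat \<Rightarrow> real ^ 'd ^ 'd" where "P \<equiv> rls_P \<phi> P0"

abbreviation I :: "nat \<Rightarrow> real ^ 'd \<Rightarrow> real ^ 'd" where "I \<equiv> information L \<phi>"

lemma linear_information: "linear (I k)"
  unfolding information_def using linear_L
  by (auto simp: linear_iff sum.distrib scaleR_sum_right inner_add_right algebra_simps)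

lemma information_Suc: "I (Suc k) x = I k x + (\<phi> (Suc k) \<bullet> x) *\<^sub>R \<phi> (Suc k)"
  by (simp add: information_def)

lemma inner_information: "x \<bullet> I k x = x \<bullet> L x + (\<Sum>l<k. (\<phi> (Suc l) \<bullet> x)\<^sup>2)"
  by (simp add: information_def inner_add_right inner_sum_right power2_eq_square inner_commute)

lemma inner_L_nonneg: "0 \<le> x \<bullet> L x"
  using c_pos by (intro order_trans[OF _ L_coercive]) simp

lemma inner_information_nonneg: "0 \<le> x \<bullet> I k x"
  unfolding inner_information by (intro add_nonneg_nonneg inner_L_nonneg sum_nonneg) auto

text \<open>
  The Sherman--Morrison identity behind the recursion for \<open>P\<close>. Since the
  information operator dominates the coercive \<open>L\<close>, the identity at step \<open>k\<close> also shows that the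
  denominator \<open>1 + v \<bullet> P v\<close> of the next step is positive, which carries the induction.
\<close>

lemma information_P: "I k (P k *v x) = x"
proof (induction k arbitrary: x)
  case 0
  then show ?case by (simp add: information_def L_P0)
next
  case (Suc k)
  interpret I: linear "I k" by (rule linear_information)
  let ?v = "\<phi> (Suc k)"
  define q where "q = ?v \<bullet> (P k *v ?v)"
  define h where "h = ?v \<bullet> (P k *v x)"
  have pos: "1 + q > 0"
    using inner_information_nonneg[of "P k *v ?v" k] Suc[of ?v]
    by (simp add: q_def inner_commute)
  have Px: "P (Suc k) *v x = P k *v x - (inverse (1 + q) * h) *\<^sub>R (P k *v ?v)"
    unfolding rls_P_Suc_mult_vector q_def h_def ..
  have "I (Suc k) (P (Suc k) *v x) = x + (h - inverse (1 + q) * h * (1 + q)) *\<^sub>R ?v"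
    unfolding information_Suc Px
    by (simp add: I.diff I.scaleR Suc inner_diff_right algebra_simps flip: q_def h_def)
  also have "h - inverse (1 + q) * h * (1 + q) = 0" using pos by (simp add: field_simps)
  finally show ?case by simp
qed

lemma one_plus_quadratic_pos: "1 + \<phi> (Suc k) \<bullet> (P k *v \<phi> (Suc k)) > 0"
  using inner_information_nonneg[of "P k *v \<phi> (Suc k)" k]
  by (simp add: information_P inner_commute)

text \<open>
  The normal equations of least squares: each observation adds \<open>d \<phi>\<close> to the image of the error under
  the information operator.
\<close>

lemma information_error:
  assumes "\<And>l. l < k \<Longrightarrow> y (Suc l) = \<phi> (Suc l) \<bullet> \<theta> + d (Suc l)"
  shows "I k (rls_estimate \<phi> y \<theta>0 P0 k - \<theta>) = L (\<theta>0 - \<theta>) + (\<Sum>l<k. d (Suc l) *\<^sub>R \<phi> (Suc l))"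
  using assms
proof (induction k)
  case 0
  then show ?case by (simp add: information_def)
next
  case (Suc k)
  interpret I: linear "I k" by (rule linear_information)
  let ?v = "\<phi> (Suc k)"
  define q where "q = ?v \<bullet> (P k *v ?v)"
  define x where "x = rls_estimate \<phi> y \<theta>0 P0 k - \<theta>"
  define h where "h = d (Suc k) - ?v \<bullet> x"
  have pos: "1 + q > 0" unfolding q_def by (rule one_plus_quadratic_pos)
  have y: "y (Suc k) - ?v \<bullet> rls_estimate \<phi> y \<theta>0 P0 k = h"
    using Suc.prems[of k] by (simp add: h_def x_def inner_diff_right)
  have est: "rls_estimate \<phi> y \<theta>0 P0 (Suc k) - \<theta> = x + (inverse (1 + q) * h) *\<^sub>R (P k *v ?v)"
    by (simp add: Let_def y x_def flip: q_def)
  have "I (Suc k) (rls_estimate \<phi> y \<theta>0 P0 (Suc k) - \<theta>)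
      = I k x + (?v \<bullet> x + inverse (1 + q) * h * (1 + q)) *\<^sub>R ?v"
    unfolding information_Suc est
    by (simp add: I.add I.scaleR information_P inner_add_right algebra_simps flip: q_def)
  also have "?v \<bullet> x + inverse (1 + q) * h * (1 + q) = d (Suc k)"
    using pos by (simp add: h_def field_simps)
  also have "I k x = L (\<theta>0 - \<theta>) + (\<Sum>l<k. d (Suc l) *\<^sub>R \<phi> (Suc l))"
    unfolding x_def using Suc by simp
  finally show ?case by (simp add: add.assoc)
qed

text \<open>
  The sharp bound, valid along trajectories on which the regressors excite all directions.
\<close>

lemma error_le_of_excitation:
  assumes y: "\<And>l. l < k \<Longrightarrow> y (Suc l) = \<phi> (Suc l) \<bullet> \<theta> + d (Suc l)"
    and exc: "\<And>x. (\<Sum>l<k. (\<phi> (Suc l) \<bullet> x)\<^sup>2) \<ge> h * (norm x)\<^sup>2" and "h > 0"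
  shows "norm (rls_estimate \<phi> y \<theta>0 P0 k - \<theta>)
           \<le> (norm (L (\<theta>0 - \<theta>)) + norm (\<Sum>l<k. d (Suc l) *\<^sub>R \<phi> (Suc l))) / h"
proof -
  define x where "x = rls_estimate \<phi> y \<theta>0 P0 k - \<theta>"
  define b where "b = L (\<theta>0 - \<theta>) + (\<Sum>l<k. d (Suc l) *\<^sub>R \<phi> (Suc l))"
  have "h * (norm x)\<^sup>2 \<le> x \<bullet> I k x"
    using exc[of x] inner_L_nonneg[of x] unfolding inner_information by simp
  also have "\<dots> = x \<bullet> b" using information_error[OF y, of k \<theta>0] by (simp add: x_def b_def)
  also have "\<dots> \<le> norm x * norm b" by (rule norm_cauchy_schwarz)
  finally have "norm x * (h * norm x) \<le> norm x * norm b" by (simp add: power2_eq_square mult_ac)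
  then have "h * norm x \<le> norm b" by (cases "x = 0") auto
  also have "\<dots> \<le> norm (L (\<theta>0 - \<theta>)) + norm (\<Sum>l<k. d (Suc l) *\<^sub>R \<phi> (Suc l))"
    unfolding b_def by (rule norm_triangle_ineq)
  finally show ?thesis using \<open>h > 0\<close> by (simp add: x_def field_simps)
qed

text \<open>
  The crude bound, valid along every trajectory: the regressor contributions to the information
  absorb half of the cross terms \<open>d (\<phi> \<bullet> x)\<close>, so only the noise energy and the coercivity of \<open>L\<close>
  remain.
\<close>

lemma error_le_noise_energy:
  assumes y: "\<And>l. l < k \<Longrightarrow> y (Suc l) = \<phi> (Suc l) \<bullet> \<theta> + d (Suc l)"
  shows "(norm (rls_estimate \<phi> y \<theta>0 P0 k - \<theta>))\<^sup>2
           \<le> (norm (L (\<theta>0 - \<theta>)) / c)\<^sup>2 + (\<Sum>l<k. (d (Suc l))\<^sup>2) / c"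
proof -
  define x where "x = rls_estimate \<phi> y \<theta>0 P0 k - \<theta>"
  define b where "b = L (\<theta>0 - \<theta>)"
  define N where "N = norm b"
  have "c * (norm x)\<^sup>2 + (\<Sum>l<k. (\<phi> (Suc l) \<bullet> x)\<^sup>2) \<le> x \<bullet> I k x"
    using L_coercive[of x] unfolding inner_information by simp
  also have "\<dots> = x \<bullet> b + (\<Sum>l<k. d (Suc l) * (\<phi> (Suc l) \<bullet> x))"
    using information_error[OF y, of k \<theta>0]
    by (simp add: x_def b_def inner_add_right inner_sum_right inner_commute)
  also have "\<dots> \<le> norm x * N + (\<Sum>l<k. ((d (Suc l))\<^sup>2 + (\<phi> (Suc l) \<bullet> x)\<^sup>2) / 2)"
  proof (intro add_mono sum_mono)
    show "d (Suc l) * (\<phi> (Suc l) \<bullet> x) \<le> ((d (Suc l))\<^sup>2 + (\<phi> (Suc l) \<bullet> x)\<^sup>2) / 2" for l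
      using sum_squares_bound[of "d (Suc l)" "\<phi> (Suc l) \<bullet> x"] by simp
  qed (simp add: norm_cauchy_schwarz N_def)
  also have "\<dots> = norm x * N + (\<Sum>l<k. (d (Suc l))\<^sup>2) / 2 + (\<Sum>l<k. (\<phi> (Suc l) \<bullet> x)\<^sup>2) / 2"
    by (simp add: sum.distrib add_divide_distrib sum_divide_distrib)
  finally have 1: "c * (norm x)\<^sup>2 \<le> norm x * N + (\<Sum>l<k. (d (Suc l))\<^sup>2) / 2"
    using sum_nonneg[of "{..<k}" "\<lambda>l. (\<phi> (Suc l) \<bullet> x)\<^sup>2"] by simp
  have "0 \<le> (c * norm x - N)\<^sup>2" by simp
  then have "2 * c * (norm x * N) \<le> c\<^sup>2 * (norm x)\<^sup>2 + N\<^sup>2"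
    by (simp add: power2_diff power_mult_distrib mult_ac)
  moreover have "2 * c * (c * (norm x)\<^sup>2) \<le> 2 * c * (norm x * N + (\<Sum>l<k. (d (Suc l))\<^sup>2) / 2)"
    using 1 c_pos by (intro mult_left_mono) auto
  ultimately have "c\<^sup>2 * (norm x)\<^sup>2 \<le> N\<^sup>2 + c * (\<Sum>l<k. (d (Suc l))\<^sup>2)"
    by (simp add: algebra_simps power2_eq_square)
  then show ?thesis using c_pos
    by (simp add: x_def b_def N_def field_simps power2_eq_square)
qed

end

text \<open>
  The minimum of the quadratic form over the unit sphere is attained and positive.
\<close>

lemma positive_definite_coercive:
  fixes R :: "real ^ 'd ^ 'd"
  assumes "positive_definite R"
  obtains c where "c > 0" "\<And>x. x \<bullet> (R *v x) \<ge> c * (norm x)\<^sup>2"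
proof -
  have cont: "continuous_on (sphere 0 1) (\<lambda>x. x \<bullet> (R *v x))"
    by (intro continuous_intros linear_continuous_on_compose[OF continuous_on_id matrix_vector_mul_linear])
  have ne: "sphere (0 :: real ^ 'd) 1 \<noteq> {}" by simp
  obtain x0 where x0: "x0 \<in> sphere 0 1" "\<And>x. x \<in> sphere 0 1 \<Longrightarrow> x0 \<bullet> (R *v x0) \<le> x \<bullet> (R *v x)"
    using continuous_attains_inf[OF compact_sphere ne cont] by auto
  define c where "c = x0 \<bullet> (R *v x0)"
  have "x \<bullet> (R *v x) \<ge> c * (norm x)\<^sup>2" for x
  proof (cases "x = 0")
    case False
    have "(inverse (norm x) *\<^sub>R x) \<in> sphere 0 1" using False by simp
    from x0(2)[OF this] have "c \<le> inverse (norm x) * (inverse (norm x) * (x \<bullet> (R *v x)))"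
      by (simp add: c_def matrix_vector_mult_scaleR)
    then show ?thesis using False by (simp add: field_simps power2_eq_square)
  qed simp
  moreover have "c > 0"
    using assms x0(1) unfolding positive_definite_def c_def by (metis norm_zero mem_sphere_0 zero_neq_one)
  ultimately show thesis using that by blast
qed

lemma positive_definite_inverse:
  fixes P0 :: "real ^ 'd ^ 'd"
  assumes "positive_definite P0"
  obtains L c where "linear L" "\<And>x. L (P0 *v x) = x" "c > 0" "\<And>x. x \<bullet> L x \<ge> c * (norm x)\<^sup>2"
proof -
  have inj: "inj ((*v) P0)"
  proof (rule injI)
    fix x y assume "P0 *v x = P0 *v y"
    then have "(x - y) \<bullet> (P0 *v (x - y)) = 0" by (simp add: matrix_vector_mult_diff_distrib)
    then show "x = y" using assms unfolding positive_definite_def by (metis less_irrefl right_minus_eq)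
  qed
  then obtain B where B: "B ** P0 = mat 1" using matrix_left_invertible_injective by blast
  then have B': "P0 ** B = mat 1" by (simp add: matrix_left_right_inverse)
  have BP: "B *v (P0 *v x) = x" and PB: "P0 *v (B *v x) = x" for x
    by (simp_all add: matrix_vector_mul_assoc B B')
  have PT: "transpose P0 = P0" using assms by (simp add: positive_definite_def)
  have "transpose B = B"
  proof -
    have "transpose B ** P0 = mat 1"
      using arg_cong[OF B', of transpose] by (simp add: matrix_transpose_mul PT)
    then show ?thesis by (metis B' matrix_mul_assoc matrix_mul_lid matrix_mul_rid)
  qed
  moreover have "x \<bullet> (B *v x) > 0" if "x \<noteq> 0" for x
  proof -
    have "B *v x \<noteq> 0" using PB[of x] that by auto
    then have "(B *v x) \<bullet> (P0 *v (B *v x)) > 0" using assms by (simp add: positive_definite_def)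
    then show ?thesis by (simp add: PB inner_commute)
  qed
  ultimately have "positive_definite B" by (simp add: positive_definite_def)
  then obtain c where "c > 0" "\<And>x. x \<bullet> (B *v x) \<ge> c * (norm x)\<^sup>2"
    by (rule positive_definite_coercive) blast
  then show thesis using that[of "(*v) B" c] BP matrix_vector_mul_linear by blast
qed

lemma quadratic_form_perturbation:
  fixes R S :: "real ^ 'd ^ 'd"
  assumes R: "\<And>x. x \<bullet> (R *v x) \<ge> c * (norm x)\<^sup>2"
    and close: "\<And>i j. \<bar>S $ i $ j - R $ i $ j\<bar> \<le> \<epsilon>"
  shows "x \<bullet> (S *v x) \<ge> (c - \<epsilon> * (real CARD('d))\<^sup>2) * (norm x)\<^sup>2"
proof -
  have expand: "x \<bullet> (A *v x) = (\<Sum>i\<in>UNIV. \<Sum>j\<in>UNIV. A $ i $ j * (x $ i * x $ j))" for A :: "real ^ 'd ^ 'd"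
    by (simp add: inner_vec_def matrix_vector_mult_def sum_distrib_left mult_ac)
  have "x \<bullet> (R *v x) - x \<bullet> (S *v x) = (\<Sum>i\<in>UNIV. \<Sum>j\<in>UNIV. (R $ i $ j - S $ i $ j) * (x $ i * x $ j))"
    by (simp add: expand sum_subtractf left_diff_distrib)
  also have "\<dots> \<le> (\<Sum>i\<in>(UNIV :: 'd set). \<Sum>j\<in>(UNIV :: 'd set). \<epsilon> * (norm x)\<^sup>2)"
  proof (intro sum_mono)
    fix i j :: 'd
    have "(R $ i $ j - S $ i $ j) * (x $ i * x $ j) \<le> \<bar>R $ i $ j - S $ i $ j\<bar> * (\<bar>x $ i\<bar> * \<bar>x $ j\<bar>)"
      by (metis abs_ge_self abs_mult)
    also have "\<dots> \<le> \<epsilon> * (norm x * norm x)"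
      using close[of i j] component_le_norm_cart[of x]
      by (intro mult_mono) (auto simp: abs_minus_commute)
    finally show "(R $ i $ j - S $ i $ j) * (x $ i * x $ j) \<le> \<epsilon> * (norm x)\<^sup>2"
      by (simp add: power2_eq_square)
  qed
  also have "\<dots> = \<epsilon> * (real CARD('d))\<^sup>2 * (norm x)\<^sup>2" by (simp add: power2_eq_square)
  finally show ?thesis using R[of x] by (simp add: algebra_simps)
qed

lemma regressor_inner_parameter:
  fixes idx :: "'d::finite \<Rightarrow> nat"
  assumes "bij_betw idx UNIV {1..m + n}"
  shows "regressor m idx y u k \<omega> \<bullet> arx_parameter m a b idx
    = - (\<Sum>i=1..m. a i * y (k - int i) \<omega>) + (\<Sum>i=1..n. b i * u (k - int i) \<omega>)"
proof -
  let ?g = "\<lambda>i. if i \<le> m then - y (k - int i) \<omega> * a i else u (k - int (i - m)) \<omega> * b (i - m)"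
  have "regressor m idx y u k \<omega> \<bullet> arx_parameter m a b idx = (\<Sum>c\<in>UNIV. ?g (idx c))"
    by (auto simp: inner_vec_def regressor_def arx_parameter_def intro!: sum.cong)
  also have "\<dots> = (\<Sum>i\<in>{1..m + n}. ?g i)" by (rule sum.reindex_bij_betw[OF assms])
  also have "{1..m + n} = {1..m} \<union> {m + 1..m + n}" by auto
  also have "sum ?g \<dots> = sum ?g {1..m} + sum ?g {m + 1..m + n}"
    by (intro sum.union_disjoint) auto
  also have "sum ?g {m + 1..m + n} = (\<Sum>i\<in>{1..n}. ?g (i + m))"
    using sum.shift_bounds_cl_nat_ivl[of ?g 1 m n] by (simp add: add.commute)
  finally show ?thesis by (simp add: sum_negf mult.commute)
qed

lemma rls_P_measurable:
  fixes \<phi> :: "nat \<Rightarrow> 'a \<Rightarrow> real ^ 'd"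
  assumes [measurable]: "\<And>l c. (\<lambda>\<omega>. \<phi> l \<omega> $ c) \<in> borel_measurable M"
  shows "(\<lambda>\<omega>. rls_P (\<lambda>l. \<phi> l \<omega>) P0 k $ i $ j) \<in> borel_measurable M"
proof (induction k arbitrary: i j)
  case (Suc k)
  note [measurable] = Suc
  show ?case
    by (simp add: Let_def matrix_matrix_mult_def outer_product_def inner_vec_def matrix_vector_mult_def)
qed simp

lemma rls_estimate_measurable:
  fixes \<phi> :: "nat \<Rightarrow> 'a \<Rightarrow> real ^ 'd" and y :: "nat \<Rightarrow> 'a \<Rightarrow> real"
  assumes [measurable]: "\<And>l c. (\<lambda>\<omega>. \<phi> l \<omega> $ c) \<in> borel_measurable M" "\<And>l. y l \<in> borel_measurable M"
  shows "(\<lambda>\<omega>. rls_estimate (\<lambda>l. \<phi> l \<omega>) (\<lambda>l. y l \<omega>) \<theta>0 P0 k $ i) \<in> borel_measurable M"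
proof (induction k arbitrary: i)
  case (Suc k)
  note [measurable] = Suc rls_P_measurable[of \<phi> M, OF assms(1)]
  show ?case
    by (simp add: Let_def inner_vec_def matrix_vector_mult_def)
qed simp

section \<open>The moment rate of the estimation error\<close>

context prob_space
begin

lemma avg_outer_product_component:
  fixes \<phi> :: "int \<Rightarrow> 'a \<Rightarrow> real ^ 'd::finite"
  assumes avg: "has_avg_expectation (\<lambda>l \<omega>. outer_product (\<phi> l \<omega>) (\<phi> l \<omega>)) R"
    and int: "\<And>l i j. integrable M (\<lambda>\<omega>. \<phi> l \<omega> $ i * \<phi> l \<omega> $ j)"
  shows "(\<lambda>k. (1 / real k) * (\<Sum>l<k. expectation (\<lambda>\<omega>. \<phi> (int l + 1) \<omega> $ i * \<phi> (int l + 1) \<omega> $ j)))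
            \<longlonglongrightarrow> R $ i $ j"
proof -
  have intM: "integrable M (\<lambda>\<omega>. outer_product (\<phi> l \<omega>) (\<phi> l \<omega>))" for l
  proof (rule Bochner_Integration.integrable_bound)
    show "integrable M (\<lambda>\<omega>. \<Sum>i\<in>UNIV. \<Sum>j\<in>UNIV. \<bar>\<phi> l \<omega> $ i * \<phi> l \<omega> $ j\<bar>)"
      using int by (intro Bochner_Integration.integrable_sum integrable_abs)
    have [measurable]: "(\<lambda>\<omega>. \<phi> l \<omega> $ i * \<phi> l \<omega> $ j) \<in> borel_measurable M" for i j
      using int by blast
    show "(\<lambda>\<omega>. outer_product (\<phi> l \<omega>) (\<phi> l \<omega>)) \<in> borel_measurable M"
      by (subst borel_measurable_euclidean_space)
        (auto simp: Basis_vec_def inner_axis outer_product_def)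
    have "norm (outer_product v v) \<le> (\<Sum>i\<in>UNIV. \<Sum>j\<in>UNIV. \<bar>v $ i * v $ j\<bar>)" for v :: "real ^ 'd"
      unfolding norm_vec_def[of "outer_product v v"]
      by (intro order_trans[OF L2_set_le_sum] sum_mono order_trans[OF norm_le_l1_cart])
        (auto simp: outer_product_def)
    then show "AE \<omega> in M. norm (outer_product (\<phi> l \<omega>) (\<phi> l \<omega>))
        \<le> norm (\<Sum>i\<in>UNIV. \<Sum>j\<in>UNIV. \<bar>\<phi> l \<omega> $ i * \<phi> l \<omega> $ j\<bar>)"
      by (intro AE_I2) (simp add: sum_nonneg)
  qed
  have bl: "bounded_linear (\<lambda>A :: real ^ 'd ^ 'd. A $ i $ j)"
    by (intro bounded_linear_compose[OF bounded_linear_vec_nth bounded_linear_vec_nth])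
  have "(\<lambda>k. ((1 / real k) *\<^sub>R (\<Sum>l=1..k. expectation (\<lambda>\<omega>. outer_product (\<phi> (int l) \<omega>) (\<phi> (int l) \<omega>)))) $ i $ j)
      \<longlonglongrightarrow> R $ i $ j"
    using avg unfolding has_avg_expectation_def by (intro tendsto_vec_nth)
  moreover have "((1 / real k) *\<^sub>R (\<Sum>l=1..k. expectation (\<lambda>\<omega>. outer_product (\<phi> (int l) \<omega>) (\<phi> (int l) \<omega>)))) $ i $ j
      = (1 / real k) * (\<Sum>l<k. expectation (\<lambda>\<omega>. \<phi> (int l + 1) \<omega> $ i * \<phi> (int l + 1) \<omega> $ j))" for k
  proof -
    have "(\<Sum>l=1..k. expectation (\<lambda>\<omega>. outer_product (\<phi> (int l) \<omega>) (\<phi> (int l) \<omega>))) $ i $ j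
        = (\<Sum>l=1..k. expectation (\<lambda>\<omega>. \<phi> (int l) \<omega> $ i * \<phi> (int l) \<omega> $ j))"
      using integral_bounded_linear[OF bl intM] by (simp add: outer_product_def)
    also have "\<dots> = (\<Sum>l<k. expectation (\<lambda>\<omega>. \<phi> (int (Suc l)) \<omega> $ i * \<phi> (int (Suc l)) \<omega> $ j))"
      by (simp only: One_nat_def sum.atLeast_Suc_atMost_Suc_shift sum.atLeast1_atMost_eq)
    finally show ?thesis by (simp add: add.commute)
  qed
  ultimately show ?thesis by (simp only:)
qed

end

context innovations
begin

lemma noise_energy_bound:
  assumes "lin_filter d" and d[measurable]: "\<And>l. random_variable borel (d l)" and "c > 0"
  shows "\<exists>C. \<forall>k>0. integrable M (\<lambda>\<omega>. ((\<Sum>l<k. w + (d (int l + 1) \<omega>)\<^sup>2 / c) / real k) ^ (2 * \<gamma>)) \<and>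
    expectation (\<lambda>\<omega>. ((\<Sum>l<k. w + (d (int l + 1) \<omega>)\<^sup>2 / c) / real k) ^ (2 * \<gamma>)) \<le> C"
proof -
  define p where "p = 2 * \<gamma>"
  have p: "even p" "p > 0" using \<gamma>_pos by (auto simp: p_def)
  obtain C where C: "\<And>l. integrable M (\<lambda>\<omega>. d l \<omega> ^ (4 * \<gamma>))"
      "\<And>l. expectation (\<lambda>\<omega>. d l \<omega> ^ (4 * \<gamma>)) \<le> C"
    using lin_filter_power_bound[OF assms(1,2)] by blast
  define X where "X l \<omega> = w + (d (int l + 1) \<omega>)\<^sup>2 / c" for l :: nat and \<omega>
  have dp: "((d l \<omega>)\<^sup>2 / c) ^ p = d l \<omega> ^ (4 * \<gamma>) / c ^ p" for l \<omega>
    by (simp add: power_divide p_def flip: power_mult)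
  have [measurable]: "random_variable borel (X l)" for l unfolding X_def by measurable
  have intX: "integrable M (\<lambda>\<omega>. X l \<omega> ^ p)" for l
    unfolding X_def using p by (intro integrable_power_add) (auto simp: dp C)
  have EX: "expectation (\<lambda>\<omega>. X l \<omega> ^ p) \<le> 2 ^ p * (w ^ p + C / c ^ p)" for l
  proof -
    have "expectation (\<lambda>\<omega>. X l \<omega> ^ p) \<le> expectation (\<lambda>\<omega>. 2 ^ p * (w ^ p + d (int l + 1) \<omega> ^ (4 * \<gamma>) / c ^ p))"
    proof (rule integral_mono[OF intX])
      show "X l \<omega> ^ p \<le> 2 ^ p * (w ^ p + d (int l + 1) \<omega> ^ (4 * \<gamma>) / c ^ p)" for \<omega>
        using power_add_le_even[OF p(1), of w "(d (int l + 1) \<omega>)\<^sup>2 / c"] by (simp add: X_def dp)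
    qed (use C in auto)
    also have "\<dots> = 2 ^ p * (w ^ p + expectation (\<lambda>\<omega>. d (int l + 1) \<omega> ^ (4 * \<gamma>)) / c ^ p)"
      using C by (simp add: prob_space)
    also have "\<dots> \<le> 2 ^ p * (w ^ p + C / c ^ p)"
      using C \<open>c > 0\<close> by (intro mult_left_mono add_left_mono divide_right_mono) auto
    finally show ?thesis .
  qed
  have "integrable M (\<lambda>\<omega>. ((\<Sum>l<k. X l \<omega>) / real k) ^ p) \<and>
    expectation (\<lambda>\<omega>. ((\<Sum>l<k. X l \<omega>) / real k) ^ p) \<le> 2 ^ p * (w ^ p + C / c ^ p)" if "k > 0" for k
  proof -
    have int: "integrable M (\<lambda>\<omega>. ((\<Sum>l<k. X l \<omega>) / real k) ^ p)"
      unfolding power_divide using p intX by (intro integrable_divide integrable_power_sum) auto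
    have "expectation (\<lambda>\<omega>. ((\<Sum>l<k. X l \<omega>) / real k) ^ p) \<le> expectation (\<lambda>\<omega>. \<Sum>l<k. (1 / real k) * X l \<omega> ^ p)"
    proof (rule integral_mono[OF int])
      show "integrable M (\<lambda>\<omega>. \<Sum>l<k. (1 / real k) * X l \<omega> ^ p)" using intX by auto
      fix \<omega>
      have "(\<Sum>l<k. (1 / real k) * X l \<omega>) ^ p
          \<le> (\<Sum>l<k. 1 / real k) ^ (p - 1) * (\<Sum>l<k. (1 / real k) * X l \<omega> ^ p)"
        using p by (intro weighted_sum_power_le) auto
      then show "((\<Sum>l<k. X l \<omega>) / real k) ^ p \<le> (\<Sum>l<k. (1 / real k) * X l \<omega> ^ p)"
        using that by (simp add: sum_divide_distrib)
    qed
    also have "\<dots> = (\<Sum>l<k. (1 / real k) * expectation (\<lambda>\<omega>. X l \<omega> ^ p))"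
      using intX by (simp add: sum_divide_distrib)
    also have "\<dots> \<le> (\<Sum>l<k. (1 / real k) * (2 ^ p * (w ^ p + C / c ^ p)))"
      using EX by (intro sum_mono mult_left_mono) auto
    also have "\<dots> = 2 ^ p * (w ^ p + C / c ^ p)" using that by simp
    finally show ?thesis using int by simp
  qed
  then show ?thesis unfolding X_def p_def by blast
qed

text \<open>
  For large \<open>k\<close>, the time average of \<open>\<phi> \<phi>\<^sup>T\<close> is close to \<open>R\<close> unless some centred sum \<open>Q i j k\<close> exceeds a fixed multiple
  of \<open>k\<close>. In the first case the sharp error bound applies, with the sums \<open>V i k\<close> of order \<open>k\<^sup>1\<^sup>/\<^sup>2\<close>.
  In the second case the normalised even power \<open>B k\<close> of the \<open>Q i j k\<close> is at least 1, so it serves as a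
  majorant of the indicator of the event, and its expectation is \<open>O(k\<^sup>-\<^sup>\<gamma>)\<close>; there the crude bound by
  the noise energy suffices. The function \<open>H k\<close> dominates the scaled error in both cases, and its
  expectation is bounded in \<open>k\<close>.
\<close>

theorem rls_moment_rate:
  fixes \<phi> :: "int \<Rightarrow> 'a \<Rightarrow> real ^ 'd::finite" and d y :: "int \<Rightarrow> 'a \<Rightarrow> real"
    and \<theta> \<theta>0 :: "real ^ 'd" and P0 R :: "real ^ 'd ^ 'd"
  assumes \<phi>: "\<And>c. lin_filter (\<lambda>l \<omega>. \<phi> l \<omega> $ c)"
    and \<phi>_meas[measurable]: "\<And>l c. random_variable borel (\<lambda>\<omega>. \<phi> l \<omega> $ c)"
    and d: "lin_filter d" and d_meas[measurable]: "\<And>l. random_variable borel (d l)"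
    and y_meas[measurable]: "\<And>l. random_variable borel (y l)"
    and uncorrelated: "\<And>l c. l \<ge> 1 \<Longrightarrow> expectation (\<lambda>\<omega>. \<phi> l \<omega> $ c * d l \<omega>) = 0"
    and y: "\<And>l. l \<ge> 1 \<Longrightarrow> AE \<omega> in M. y l \<omega> = \<phi> l \<omega> \<bullet> \<theta> + d l \<omega>"
    and avg: "has_avg_expectation (\<lambda>l \<omega>. outer_product (\<phi> l \<omega>) (\<phi> l \<omega>)) R"
    and R: "positive_definite R" and P0: "positive_definite P0"
  defines "err \<equiv> \<lambda>k \<omega>. rls_estimate (\<lambda>l. \<phi> (int l) \<omega>) (\<lambda>l. y (int l) \<omega>) \<theta>0 P0 k - \<theta>"
  shows "(\<forall>k. integrable M (\<lambda>\<omega>. norm (err k \<omega>) powr (real \<gamma> / 2))) \<and>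
         (\<lambda>k. expectation (\<lambda>\<omega>. norm (err k \<omega>) powr (real \<gamma> / 2)))
           \<in> O(\<lambda>k. 1 / real k powr (real \<gamma> / 4))"
proof -
  define p where "p = 2 * \<gamma>"
  have p: "even p" "p > 0" using \<gamma>_pos by (auto simp: p_def)
  define D where "D = real CARD('d)"
  have D: "D > 0" by (simp add: D_def)
  obtain L c where L: "linear L" "\<And>x. L (P0 *v x) = x" and c: "c > 0"
    and Lc: "\<And>x. x \<bullet> L x \<ge> c * (norm x)\<^sup>2"
    using positive_definite_inverse[OF P0] by blast
  obtain r where r: "r > 0" and Rr: "\<And>x. x \<bullet> (R *v x) \<ge> r * (norm x)\<^sup>2"
    using positive_definite_coercive[OF R] by blast
  \<comment> \<open>An entrywise perturbation by this amount costs at most half of the coercivity constant r.\<close>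
  define \<epsilon> where "\<epsilon> = r / (2 * D\<^sup>2)"
  have \<epsilon>: "\<epsilon> > 0" "r - \<epsilon> * D\<^sup>2 = r / 2" using r D by (auto simp: \<epsilon>_def field_simps)
  define N0 where "N0 = norm (L (\<theta>0 - \<theta>))"
  define w where "w = (N0 / c)\<^sup>2"
  define n where "n k \<omega> = norm (err k \<omega>)" for k \<omega>
  define U where "U k \<omega> = (\<Sum>l<k. w + (d (int l + 1) \<omega>)\<^sup>2 / c)" for k \<omega>
  define E where "E i j l = expectation (\<lambda>\<omega>. \<phi> (int l + 1) \<omega> $ i * \<phi> (int l + 1) \<omega> $ j)" for i j and l :: nat
  define Q where "Q i j k \<omega> = (\<Sum>l<k. \<phi> (int l + 1) \<omega> $ i * \<phi> (int l + 1) \<omega> $ j - E i j l)" for i j k \<omega>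
  define V where "V i k \<omega> = (\<Sum>l<k. \<phi> (int l + 1) \<omega> $ i * d (int l + 1) \<omega>)" for i k \<omega>
  have [measurable]: "random_variable borel (Q i j k)" "random_variable borel (V i k)" for i j k
    unfolding Q_def V_def by measurable
  have n_meas[measurable]: "random_variable borel (n k)" for k
  proof -
    have [measurable]: "random_variable borel (\<lambda>\<omega>. rls_estimate (\<lambda>l. \<phi> (int l) \<omega>) (\<lambda>l. y (int l) \<omega>) \<theta>0 P0 k $ i)" for i
      by (rule rls_estimate_measurable) measurable
    show ?thesis unfolding n_def err_def norm_vec_def L2_set_def by simp
  qed
  have int_\<phi>\<phi>: "integrable M (\<lambda>\<omega>. (\<phi> l \<omega> $ i * \<phi> l \<omega> $ j) ^ p)" "integrable M (\<lambda>\<omega>. \<phi> l \<omega> $ i * \<phi> l \<omega> $ j)" for i j l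
    using lin_filter_product_integrable[OF \<phi>[of i] \<phi>[of j]] by (auto simp: p_def)
  have int_\<phi>d: "integrable M (\<lambda>\<omega>. (\<phi> l \<omega> $ i * d l \<omega>) ^ p)" for i l
    using lin_filter_product_integrable[OF \<phi>[of i] d] by (auto simp: p_def)
  have intQ: "integrable M (\<lambda>\<omega>. Q i j k \<omega> ^ p)" for i j k
    unfolding Q_def diff_conv_add_uminus using p
    by (intro integrable_power_sum integrable_power_add) (auto intro: int_\<phi>\<phi>)
  have intV: "integrable M (\<lambda>\<omega>. V i k \<omega> ^ p)" for i k
    unfolding V_def using p by (intro integrable_power_sum) (auto intro: int_\<phi>d)
  have "\<exists>C :: real. C \<ge> 0 \<and> (\<forall>k. expectation (\<lambda>\<omega>. Q i j k \<omega> ^ p) \<le> C * real k ^ \<gamma>)" for i j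
    using lin_filter_centred_sum_bound[OF \<phi>[of i] \<phi>[of j]] unfolding Q_def E_def p_def by simp
  then obtain CQ where CQ: "\<And>i j. (CQ i j :: real) \<ge> 0"
    "\<And>i j k. expectation (\<lambda>\<omega>. Q i j k \<omega> ^ p) \<le> CQ i j * real k ^ \<gamma>"
    by metis
  have "\<exists>C :: real. C \<ge> 0 \<and> (\<forall>k. expectation (\<lambda>\<omega>. V i k \<omega> ^ p) \<le> C * real k ^ \<gamma>)" for i
    using lin_filter_centred_sum_bound[OF \<phi>[of i] d] unfolding V_def p_def by (simp add: uncorrelated)
  then obtain CV where CV: "\<And>i. (CV i :: real) \<ge> 0"
    "\<And>i k. expectation (\<lambda>\<omega>. V i k \<omega> ^ p) \<le> CV i * real k ^ \<gamma>"
    by metis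
  obtain CU where CU: "\<And>k. k > 0 \<Longrightarrow> integrable M (\<lambda>\<omega>. (U k \<omega> / real k) ^ p)"
    "\<And>k. k > 0 \<Longrightarrow> expectation (\<lambda>\<omega>. (U k \<omega> / real k) ^ p) \<le> CU"
    using noise_energy_bound[OF d d_meas c, of w] unfolding U_def p_def by blast

  interpret run: rls_run "\<lambda>l. \<phi> (int l) \<omega>" P0 L c for \<omega>
    by (rule rls_run.intro) (use L c Lc in auto)
  have y_all: "AE \<omega> in M. \<forall>l :: nat. y (int (Suc l)) \<omega> = \<phi> (int (Suc l)) \<omega> \<bullet> \<theta> + d (int (Suc l)) \<omega>"
    by (subst AE_all_countable) (auto intro!: y)
  have crude: "AE \<omega> in M. (n k \<omega>)\<^sup>2 \<le> w + (\<Sum>l<k. (d (int l + 1) \<omega>)\<^sup>2) / c" for k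
    using y_all
  proof eventually_elim
    case (elim \<omega>)
    show ?case
      using run.error_le_noise_energy[of k "\<lambda>l. y (int l) \<omega>" \<omega> \<theta> "\<lambda>l. d (int l) \<omega>" \<theta>0] elim
      by (simp add: n_def err_def w_def N0_def add.commute)
  qed
  have int_n: "integrable M (\<lambda>\<omega>. n k \<omega> powr (real \<gamma> / 2))" for k
  proof (rule Bochner_Integration.integrable_bound)
    let ?W = "\<lambda>\<omega>. w + (\<Sum>l<k. (d (int l + 1) \<omega>)\<^sup>2 / c)"
    have "integrable M (\<lambda>\<omega>. ((d l \<omega>)\<^sup>2 / c) ^ p)" for l
      using lin_filter_power_bound[OF d d_meas] by (auto simp: power_divide p_def simp flip: power_mult)
    then show "integrable M (\<lambda>\<omega>. 1 + ?W \<omega> ^ p)"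
      using p by (intro Bochner_Integration.integrable_add integrable_power_add integrable_power_sum) auto
    show "AE \<omega> in M. norm (n k \<omega> powr (real \<gamma> / 2)) \<le> norm (1 + ?W \<omega> ^ p)"
      using crude[of k]
    proof eventually_elim
      case (elim \<omega>)
      have "n k \<omega> powr (real \<gamma> / 2) \<le> 1 + n k \<omega> ^ (2 * p)"
        by (intro powr_le_one_plus_power) (auto simp: n_def p_def)
      also have "n k \<omega> ^ (2 * p) = ((n k \<omega>)\<^sup>2) ^ p" by (simp flip: power_mult)
      also have "\<dots> \<le> ?W \<omega> ^ p"
        using elim by (intro power_mono) (auto simp: sum_divide_distrib)
      finally show ?case using p by (simp add: zero_le_even_power)
    qed
  qed measurable

  have "\<forall>\<^sub>F k in sequentially. \<forall>i\<in>UNIV. \<forall>j\<in>UNIV. \<bar>(1 / real k) * (\<Sum>l<k. E i j l) - R $ i $ j\<bar> < \<epsilon> / 2"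
    using tendstoD[OF avg_outer_product_component[OF avg int_\<phi>\<phi>(2)], of "\<epsilon> / 2"] \<epsilon>
    by (intro eventually_ball_finite finite_UNIV ballI) (auto simp: E_def dist_real_def)
  then have ev: "\<forall>\<^sub>F k in sequentially. k > 0 \<and>
      (\<forall>i j. \<bar>(1 / real k) * (\<Sum>l<k. E i j l) - R $ i $ j\<bar> < \<epsilon> / 2)"
    using eventually_gt_at_top[of "0 :: nat"] by eventually_elim auto

  define B where "B k \<omega> = (\<Sum>i\<in>UNIV. \<Sum>j\<in>UNIV. (Q i j k \<omega> / (real k * (\<epsilon> / 2))) ^ p)" for k \<omega>
  \<comment> \<open>A dominates the even power of the numerator of the sharp bound; B dominates the indicator of poor excitation.\<close>
  define A where "A k \<omega> = 2 ^ p * (N0 ^ p + D ^ (p - 1) * (\<Sum>i\<in>UNIV. V i k \<omega> ^ p))" for k \<omega>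
  define H where "H k \<omega> = 2 + A k \<omega> / (r / 2) ^ p / real k ^ \<gamma> + real k ^ \<gamma> * B k \<omega> + (U k \<omega> / real k) ^ p" for k \<omega>
  have B0: "B k \<omega> \<ge> 0" for k \<omega>
    unfolding B_def using p by (intro sum_nonneg) (simp add: zero_le_even_power)
  have A_ge: "(N0 + (\<Sum>i\<in>UNIV. \<bar>V i k \<omega>\<bar>)) ^ p \<le> A k \<omega>" for k \<omega>
  proof -
    have "(\<Sum>i\<in>UNIV. 1 * \<bar>V i k \<omega>\<bar>) ^ p \<le> (\<Sum>i\<in>(UNIV :: 'd set). 1) ^ (p - 1) * (\<Sum>i\<in>UNIV. 1 * \<bar>V i k \<omega>\<bar> ^ p)"
      using p by (intro weighted_sum_power_le) auto
    then have "(\<Sum>i\<in>UNIV. \<bar>V i k \<omega>\<bar>) ^ p \<le> D ^ (p - 1) * (\<Sum>i\<in>UNIV. V i k \<omega> ^ p)"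
      using p by (simp add: D_def power_even_abs)
    then have "2 ^ p * (N0 ^ p + (\<Sum>i\<in>UNIV. \<bar>V i k \<omega>\<bar>) ^ p) \<le> A k \<omega>"
      unfolding A_def by simp
    then show ?thesis by (rule order_trans[OF power_add_le_even[OF p(1)]])
  qed
  have A0: "A k \<omega> \<ge> 0" for k \<omega>
    by (rule order_trans[OF _ A_ge]) (use p in \<open>simp add: zero_le_even_power\<close>)

  have good: "n k \<omega> \<le> (N0 + (\<Sum>i\<in>UNIV. \<bar>V i k \<omega>\<bar>)) / (r / 2 * k)"
    if k: "k > 0" and mean: "\<And>i j. \<bar>(1 / real k) * (\<Sum>l<k. E i j l) - R $ i $ j\<bar> < \<epsilon> / 2"
      and Qs: "\<And>i j. \<bar>Q i j k \<omega>\<bar> \<le> real k * (\<epsilon> / 2)"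
      and ys: "\<forall>l :: nat. y (int (Suc l)) \<omega> = \<phi> (int (Suc l)) \<omega> \<bullet> \<theta> + d (int (Suc l)) \<omega>" for k \<omega>
  proof -
    let ?\<phi> = "\<lambda>l. \<phi> (int (Suc l)) \<omega>"
    define S :: "real ^ 'd ^ 'd" where "S = (\<chi> i j. (1 / real k) * (\<Sum>l<k. ?\<phi> l $ i * ?\<phi> l $ j))"
    have close: "\<bar>S $ i $ j - R $ i $ j\<bar> \<le> \<epsilon>" for i j
    proof -
      have "S $ i $ j = Q i j k \<omega> / k + (1 / real k) * (\<Sum>l<k. E i j l)"
        by (simp add: S_def Q_def sum_subtractf diff_divide_distrib add.commute)
      moreover have "\<bar>Q i j k \<omega> / k\<bar> \<le> \<epsilon> / 2"
        using Qs[of i j] k by (simp add: field_simps)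
      ultimately show ?thesis using mean[of i j] by linarith
    qed
    have exc: "(\<Sum>l<k. (?\<phi> l \<bullet> x)\<^sup>2) \<ge> (r / 2 * k) * (norm x)\<^sup>2" for x
    proof -
      have "x \<bullet> (S *v x) = (\<Sum>i\<in>UNIV. \<Sum>j\<in>UNIV. \<Sum>l<k. (1 / real k) * (?\<phi> l $ i * x $ i * (?\<phi> l $ j * x $ j)))"
        by (simp add: S_def inner_vec_def matrix_vector_mult_def sum_distrib_left sum_distrib_right mult_ac)
      also have "\<dots> = (\<Sum>l<k. \<Sum>i\<in>UNIV. \<Sum>j\<in>UNIV. (1 / real k) * (?\<phi> l $ i * x $ i * (?\<phi> l $ j * x $ j)))"
        by (subst (2) sum.swap, subst sum.swap) (rule refl)
      also have "\<dots> = (1 / real k) * (\<Sum>l<k. (?\<phi> l \<bullet> x)\<^sup>2)"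
      proof -
        have "(?\<phi> l \<bullet> x)\<^sup>2 = (\<Sum>i\<in>UNIV. \<Sum>j\<in>UNIV. ?\<phi> l $ i * x $ i * (?\<phi> l $ j * x $ j))" for l
          by (simp only: inner_vec_def inner_real_def power2_eq_square sum_product)
        then show ?thesis by (simp only: sum_distrib_left)
      qed
      finally have "x \<bullet> (S *v x) = (1 / real k) * (\<Sum>l<k. (?\<phi> l \<bullet> x)\<^sup>2)" .
      then have "(\<Sum>l<k. (?\<phi> l \<bullet> x)\<^sup>2) = k * (x \<bullet> (S *v x))" using k by simp
      moreover have "r / 2 * (norm x)\<^sup>2 \<le> x \<bullet> (S *v x)"
        using quadratic_form_perturbation[OF Rr close, of x] \<epsilon>(2) by (simp add: D_def)
      then have "k * (r / 2 * (norm x)\<^sup>2) \<le> k * (x \<bullet> (S *v x))" by (rule mult_left_mono) simp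
      ultimately show ?thesis by (simp add: mult_ac)
    qed
    have "norm (\<Sum>l<k. d (int (Suc l)) \<omega> *\<^sub>R ?\<phi> l) \<le> (\<Sum>i\<in>UNIV. \<bar>V i k \<omega>\<bar>)"
      by (rule order_trans[OF norm_le_l1_cart]) (simp add: V_def mult.commute add.commute)
    then have "(N0 + norm (\<Sum>l<k. d (int (Suc l)) \<omega> *\<^sub>R ?\<phi> l)) / (r / 2 * k)
        \<le> (N0 + (\<Sum>i\<in>UNIV. \<bar>V i k \<omega>\<bar>)) / (r / 2 * k)"
      using k r by (intro divide_right_mono) auto
    moreover have "n k \<omega> \<le> (N0 + norm (\<Sum>l<k. d (int (Suc l)) \<omega> *\<^sub>R ?\<phi> l)) / (r / 2 * k)"
      unfolding n_def err_def N0_def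
      by (rule run.error_le_of_excitation[where d = "\<lambda>l. d (int l) \<omega>"]) (use ys exc k r in auto)
    ultimately show ?thesis by linarith
  qed

  have pointwise: "AE \<omega> in M. real k powr (\<gamma> / 4) * n k \<omega> powr (\<gamma> / 2) \<le> H k \<omega>"
    if k: "k > 0" and mean: "\<And>i j. \<bar>(1 / real k) * (\<Sum>l<k. E i j l) - R $ i $ j\<bar> < \<epsilon> / 2" for k
    using y_all crude[of k]
  proof eventually_elim
    case (elim \<omega>)
    have parts: "A k \<omega> / (r / 2) ^ p / real k ^ \<gamma> \<ge> 0" "real k ^ \<gamma> * B k \<omega> \<ge> 0" "(U k \<omega> / real k) ^ p \<ge> 0"
      using A0[of k \<omega>] B0[of k \<omega>] p r by (auto simp: zero_le_even_power)
    show ?case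
    proof (cases "\<forall>i j. \<bar>Q i j k \<omega>\<bar> \<le> real k * (\<epsilon> / 2)")
      case True
      have "real k powr (\<gamma> / 4) * n k \<omega> powr (\<gamma> / 2)
          \<le> 1 + ((N0 + (\<Sum>i\<in>UNIV. \<bar>V i k \<omega>\<bar>)) / (r / 2)) ^ p / real k ^ \<gamma>"
        unfolding p_def using k mean elim(1) True r
        by (intro scaled_error_power_le_good good) (auto simp: n_def)
      also have "\<dots> \<le> 1 + A k \<omega> / (r / 2) ^ p / real k ^ \<gamma>"
        unfolding power_divide[of "N0 + _"] using A_ge[of k \<omega>] r
        by (intro add_left_mono divide_right_mono) auto
      finally show ?thesis using parts by (simp add: H_def)
    next
      case False
      then obtain i j where ij: "\<bar>Q i j k \<omega>\<bar> > real k * (\<epsilon> / 2)" by (auto simp: not_le)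
      let ?q = "\<lambda>i j. (Q i j k \<omega> / (real k * (\<epsilon> / 2))) ^ p"
      have q0: "?q i j \<ge> 0" for i j using p by (simp add: zero_le_even_power)
      have "1 \<le> \<bar>Q i j k \<omega> / (real k * (\<epsilon> / 2))\<bar>"
        using ij k \<epsilon> by (simp add: field_simps)
      then have "1 \<le> \<bar>Q i j k \<omega> / (real k * (\<epsilon> / 2))\<bar> ^ p" by (rule one_le_power)
      also have "\<dots> = ?q i j" using p by (intro power_even_abs)
      also have "\<dots> \<le> (\<Sum>j\<in>UNIV. ?q i j)" using q0 by (intro member_le_sum) auto
      also have "\<dots> \<le> B k \<omega>" unfolding B_def using q0 by (intro member_le_sum[of i UNIV "\<lambda>i. sum (?q i) UNIV"] sum_nonneg) auto
      finally have "real k ^ \<gamma> * 1 \<le> real k ^ \<gamma> * B k \<omega>" by (intro mult_left_mono) auto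
      moreover have "(n k \<omega>)\<^sup>2 \<le> U k \<omega>"
      proof -
        have "w * 1 \<le> w * real k" using k by (intro mult_left_mono) (auto simp: w_def)
        then show ?thesis using elim(2) by (simp add: U_def sum.distrib sum_divide_distrib mult.commute)
      qed
      then have "real k powr (\<gamma> / 4) * n k \<omega> powr (\<gamma> / 2) \<le> real k ^ \<gamma> + (1 + (U k \<omega> / real k) ^ p)"
        unfolding p_def using k by (intro scaled_error_power_le_bad) (auto simp: n_def)
      ultimately show ?thesis using parts by (simp add: H_def)
    qed
  qed

  define CA where "CA = 2 ^ p * (N0 ^ p + D ^ (p - 1) * (\<Sum>i\<in>UNIV. CV i)) / (r / 2) ^ p"
  define CB where "CB = (\<Sum>i\<in>UNIV. \<Sum>j\<in>UNIV. CQ i j) / (\<epsilon> / 2) ^ p"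
  have intA: "integrable M (A k)" and intB: "integrable M (B k)" for k
    unfolding A_def[abs_def] B_def[abs_def] power_divide using intV intQ by auto
  have intH: "integrable M (H k)" if "k > 0" for k
    unfolding H_def[abs_def] using intA intB CU(1)[OF that] by auto
  have EH: "expectation (H k) \<le> 2 + CA + CB + CU" if k: "k > 0" for k
  proof -
    have k1: "1 \<le> real k ^ \<gamma>" using k by (intro one_le_power) auto
    have "expectation (H k) = 2 + expectation (A k) / (r / 2) ^ p / real k ^ \<gamma>
        + real k ^ \<gamma> * expectation (B k) + expectation (\<lambda>\<omega>. (U k \<omega> / real k) ^ p)"
      unfolding H_def[abs_def] using intA intB CU(1)[OF k] by (simp add: prob_space)
    moreover have "expectation (A k) / (r / 2) ^ p / real k ^ \<gamma> \<le> CA"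
    proof -
      have "expectation (A k) = 2 ^ p * (N0 ^ p + D ^ (p - 1) * (\<Sum>i\<in>UNIV. expectation (\<lambda>\<omega>. V i k \<omega> ^ p)))"
        unfolding A_def[abs_def] using intV by (simp add: prob_space)
      also have "\<dots> \<le> 2 ^ p * (N0 ^ p * real k ^ \<gamma> + D ^ (p - 1) * (\<Sum>i\<in>UNIV. CV i * real k ^ \<gamma>))"
      proof (intro mult_left_mono add_mono sum_mono CV(2))
        show "N0 ^ p \<le> N0 ^ p * real k ^ \<gamma>"
          using mult_left_mono[OF k1, of "N0 ^ p"] by (simp add: N0_def)
      qed (use D in auto)
      also have "\<dots> = CA * (r / 2) ^ p * real k ^ \<gamma>"
      proof -
        have "CA * (r / 2) ^ p = 2 ^ p * (N0 ^ p + D ^ (p - 1) * (\<Sum>i\<in>UNIV. CV i))"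
          using r by (simp add: CA_def)
        then show ?thesis unfolding sum_distrib_right[symmetric] by (simp add: algebra_simps)
      qed
      finally have "expectation (A k) \<le> CA * (r / 2) ^ p * real k ^ \<gamma>" .
      moreover have "0 < (r / 2) ^ p" "0 < real k ^ \<gamma>" using r k by simp_all
      ultimately show ?thesis by (simp only: pos_divide_le_eq mult_ac)
    qed
    moreover have "real k ^ \<gamma> * expectation (B k) \<le> CB"
    proof -
      have "expectation (B k) = (\<Sum>i\<in>UNIV. \<Sum>j\<in>UNIV. expectation (\<lambda>\<omega>. Q i j k \<omega> ^ p) / (real k * (\<epsilon> / 2)) ^ p)"
        unfolding B_def[abs_def] power_divide[of "Q _ _ _ _"] using intQ by simp
      also have "\<dots> \<le> (\<Sum>i\<in>UNIV. \<Sum>j\<in>UNIV. CQ i j * real k ^ \<gamma> / (real k * (\<epsilon> / 2)) ^ p)"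
        using \<epsilon> by (intro sum_mono divide_right_mono CQ(2)) auto
      also have "\<dots> = CB / real k ^ \<gamma>"
      proof -
        have "(real k * (\<epsilon> / 2)) ^ p = real k ^ \<gamma> * real k ^ \<gamma> * (\<epsilon> / 2) ^ p"
          by (simp add: power_mult_distrib p_def mult_2 power_add del: times_divide_eq_right)
        then have "CQ i j * real k ^ \<gamma> / (real k * (\<epsilon> / 2)) ^ p = CQ i j / (\<epsilon> / 2) ^ p / real k ^ \<gamma>" for i j
          using k by (simp del: times_divide_eq_right)
        then show ?thesis by (simp add: CB_def sum_divide_distrib)
      qed
      finally show ?thesis using k by (simp add: field_simps)
    qed
    ultimately show ?thesis using CU(2)[OF k] by linarith
  qed

  have "\<forall>\<^sub>F k in sequentially. norm (expectation (\<lambda>\<omega>. n k \<omega> powr (real \<gamma> / 2)))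
      \<le> (2 + CA + CB + CU) * norm (1 / real k powr (real \<gamma> / 4))"
    using ev
  proof eventually_elim
    case (elim k)
    then have k: "k > 0" by blast
    have "real k powr (\<gamma> / 4) * expectation (\<lambda>\<omega>. n k \<omega> powr (\<gamma> / 2))
        = expectation (\<lambda>\<omega>. real k powr (\<gamma> / 4) * n k \<omega> powr (\<gamma> / 2))"
      by simp
    also have "\<dots> \<le> expectation (H k)"
      using elim by (intro integral_mono_AE intH pointwise integrable_mult_right int_n) auto
    also have "\<dots> \<le> 2 + CA + CB + CU" by (rule EH[OF k])
    finally have "real k powr (\<gamma> / 4) * expectation (\<lambda>\<omega>. n k \<omega> powr (\<gamma> / 2)) \<le> 2 + CA + CB + CU" .
    moreover have "expectation (\<lambda>\<omega>. n k \<omega> powr (\<gamma> / 2)) \<ge> 0"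
      by (intro Bochner_Integration.integral_nonneg) simp
    ultimately show ?case using k by (simp add: field_simps)
  qed
  then have "(\<lambda>k. expectation (\<lambda>\<omega>. n k \<omega> powr (real \<gamma> / 2))) \<in> O(\<lambda>k. 1 / real k powr (real \<gamma> / 4))"
    by (rule bigoI)
  then show ?thesis using int_n unfolding n_def by blast
qed

end

section \<open>The ARX system\<close>

context innovations
begin

text \<open>
  The signal \<open>s\<close> stands for the response to the deterministic input.
\<close>

lemma lin_filter_of_stable_series:
  assumes zero: "\<And>l \<omega>. l < k0 \<Longrightarrow> \<omega> \<in> space M \<Longrightarrow> w l \<omega> = 0"
    and rep: "\<And>l. l \<ge> k0 \<Longrightarrow> AE \<omega> in M. w l \<omega> = s l + (\<Sum>i. \<beta> i l * e (l - int i) \<omega>)"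
    and s: "\<And>l. l \<ge> k0 \<Longrightarrow> \<bar>s l\<bar> \<le> B"
    and \<beta>: "\<And>i l. l \<ge> k0 \<Longrightarrow> \<bar>\<beta> i l\<bar> \<le> \<bar>g i\<bar>"
    and g: "summable (\<lambda>i. \<bar>g i\<bar> :: real)"
  shows "lin_filter w"
proof -
  define F where "F i l = (if l < k0 then 0 else case i of 0 \<Rightarrow> s l | Suc j \<Rightarrow> \<beta> j l)" for i l
  define G where "G i = (case i of 0 \<Rightarrow> \<bar>B\<bar> | Suc j \<Rightarrow> \<bar>g j\<bar>)" for i
  have "summable (\<lambda>i. G (Suc i))" using g by (simp add: G_def)
  then have "summable G" using summable_Suc_iff[of G] by blast
  moreover have "\<bar>F i l\<bar> \<le> G i" for i l
    using s[of l] \<beta>[of l] by (cases i) (auto simp: F_def G_def)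
  moreover have "AE \<omega> in M. w l \<omega> = (\<Sum>i\<le>N. F i l * basis i l \<omega>)" if l: "l < int N" for l N
  proof (cases "l < k0")
    case True
    then show ?thesis by (intro AE_I2) (simp add: F_def zero)
  next
    case False
    then have "AE \<omega> in M. w l \<omega> = s l + (\<Sum>i. \<beta> i l * e (l - int i) \<omega>)" by (intro rep) simp
    with AE_space show ?thesis
    proof eventually_elim
      case (elim \<omega>)
      have "(\<Sum>i. \<beta> i l * e (l - int i) \<omega>) = (\<Sum>i<N. \<beta> i l * e (l - int i) \<omega>)"
        using l elim(1) by (intro suminf_finite) (auto simp: e_neg)
      then show ?case
        using elim(2) False by (simp add: F_def sum.atMost_shift)
    qed
  qed
  ultimately show ?thesis unfolding lin_filter_def by blast
qed

end

lemma abs_suminf_mult_bounded_le: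
  fixes x r g :: "nat \<Rightarrow> real"
  assumes "\<And>i. \<bar>x i\<bar> \<le> \<bar>g i\<bar>" "\<And>i. \<bar>r i\<bar> \<le> B" "summable (\<lambda>i. \<bar>g i\<bar>)"
  shows "\<bar>\<Sum>i. x i * r i\<bar> \<le> (\<Sum>i. \<bar>g i\<bar>) * B"
proof -
  have "norm (\<Sum>i. x i * r i) \<le> (\<Sum>i. \<bar>g i\<bar> * B)"
    using assms by (intro norm_suminf_le summable_mult2) (auto simp: abs_mult intro!: mult_mono)
  also have "\<dots> = (\<Sum>i. \<bar>g i\<bar>) * B" using assms(3) by (rule suminf_mult2[symmetric])
  finally show ?thesis by simp
qed

theorem theorem3p2:
  fixes M :: "'a measure"
    and m n \<gamma> :: nat
    and idx :: "'d::finite \<Rightarrow> nat"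
    and a b :: "nat \<Rightarrow> real"
    and y u d :: "int \<Rightarrow> 'a \<Rightarrow> real"
    and \<delta>\<^sub>d :: real
    and \<theta>0 :: "real ^ 'd"
    and P0 :: "real ^ 'd ^ 'd"
    and err :: "nat \<Rightarrow> 'a \<Rightarrow> real ^ 'd"
  assumes "prob_space M"
    and "\<gamma> \<ge> 1"
    and "bij_betw idx UNIV {1..m + n}"
    and "prob_space.arx_system M m n a b y u d"
    and "prob_space.assumption_A M \<gamma> m idx y u"
    and "arx_stable m a"
    and "prob_space.gaussian_noise M d \<delta>\<^sub>d"
    and "prob_space.noise_uncorrelated_with_regressor M m idx y u d"
    and "positive_definite P0"
    and "\<And>k \<omega>. err k \<omega> =
           rls_estimate (\<lambda>l. regressor m idx y u (int l) \<omega>) (\<lambda>l. y (int l) \<omega>) \<theta>0 P0 k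
           - arx_parameter m a b idx"
  shows "(\<forall>k. integrable M (\<lambda>\<omega>. norm (err k \<omega>) powr (real \<gamma> / 2))) \<and>
         (\<lambda>k. integral\<^sup>L M (\<lambda>\<omega>. norm (err k \<omega>) powr (real \<gamma> / 2)))
           \<in> O(\<lambda>k. 1 / real k powr (real \<gamma> / 4))"
proof -
  interpret prob_space M by fact
  note A = assms(5)[unfolded assumption_A_def]
  obtain r e \<delta>\<^sub>e f where r: "bounded (range r)" "\<And>k. k < 0 \<Longrightarrow> r k = 0"
    and e: "\<And>k \<omega>. k < 0 \<Longrightarrow> \<omega> \<in> space M \<Longrightarrow> e k \<omega> = 0" "indep_vars (\<lambda>_. borel) e {0..}"
      "\<And>k. k \<ge> 0 \<Longrightarrow> expectation (e k) = 0 \<and> variance (e k) = \<delta>\<^sub>e\<^sup>2"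
    and eK: "\<exists>K. \<forall>k\<ge>0. integrable M (\<lambda>\<omega>. \<bar>e k \<omega>\<bar> ^ (4 * \<gamma>)) \<and>
                     expectation (\<lambda>\<omega>. \<bar>e k \<omega>\<bar> ^ (4 * \<gamma>)) \<le> K"
    and rep: "filter_representation r e f y u" and stable: "uniformly_stable f"
    using A by blast
  obtain K where K: "\<And>k. k \<ge> 0 \<Longrightarrow> integrable M (\<lambda>\<omega>. e k \<omega> ^ (4 * \<gamma>))"
      "\<And>k. k \<ge> 0 \<Longrightarrow> expectation (\<lambda>\<omega>. e k \<omega> ^ (4 * \<gamma>)) \<le> K"
    using eK by (auto simp: power_even_abs)
  interpret innovations M e \<gamma> K
    by unfold_locales (use assms(2) e K in auto)
  obtain g where g: "\<And>i k. i \<ge> 1 \<Longrightarrow> k \<ge> 1 \<Longrightarrow> \<bar>f 1 i k\<bar> \<le> \<bar>g i\<bar>"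
      "\<And>i k. k \<ge> 1 \<Longrightarrow> \<bar>f 2 i k\<bar> \<le> \<bar>g i\<bar>" "\<And>i k. k \<ge> 0 \<Longrightarrow> \<bar>f 3 i k\<bar> \<le> \<bar>g i\<bar>"
      "\<And>i k. k \<ge> 0 \<Longrightarrow> \<bar>f 4 i k\<bar> \<le> \<bar>g i\<bar>" "summable (\<lambda>i. \<bar>g i :: real\<bar>)"
    using stable unfolding uniformly_stable_def by blast
  obtain Br where Br: "\<And>k. \<bar>r k\<bar> \<le> Br"
    using r(1) by (auto simp: bounded_iff)
  have zero: "\<And>k \<omega>. k \<le> 0 \<Longrightarrow> \<omega> \<in> space M \<Longrightarrow> y k \<omega> = 0" "\<And>k \<omega>. k < 0 \<Longrightarrow> \<omega> \<in> space M \<Longrightarrow> u k \<omega> = 0"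
    and arx: "\<And>k. k \<ge> 1 \<Longrightarrow> AE \<omega> in M. y k \<omega> + (\<Sum>i=1..m. a i * y (k - int i) \<omega>) =
        (\<Sum>i=1..n. b i * u (k - int i) \<omega>) + d k \<omega>"
    using assms(4) unfolding arx_system_def by auto
  have y_rep: "AE \<omega> in M. y k \<omega> = (\<Sum>i. f 1 (Suc i) k * r (k - int (Suc i))) + (\<Sum>i. f 2 i k * e (k - int i) \<omega>)"
    if "k \<ge> 1" for k
    using rep that unfolding filter_representation_def by blast
  have u_rep: "AE \<omega> in M. u k \<omega> = (\<Sum>i. f 3 i k * r (k - int i)) + (\<Sum>i. f 4 i k * e (k - int i) \<omega>)"
    if "k \<ge> 0" for k
    using rep that unfolding filter_representation_def by blast
  have y_lin: "lin_filter y"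
  proof (rule lin_filter_of_stable_series[OF _ y_rep _ g(2,5)])
    show "\<bar>\<Sum>i. f 1 (Suc i) l * r (l - int (Suc i))\<bar> \<le> (\<Sum>i. \<bar>g (Suc i)\<bar>) * Br" if "l \<ge> 1" for l
      using that g(5) by (intro abs_suminf_mult_bounded_le g(1) Br) (simp_all add: summable_Suc_iff[of "\<lambda>i. \<bar>g i\<bar>"])
  qed (use zero in auto)
  have u_lin: "lin_filter u"
  proof (rule lin_filter_of_stable_series[OF _ u_rep _ g(4,5)])
    show "\<bar>\<Sum>i. f 3 i l * r (l - int i)\<bar> \<le> (\<Sum>i. \<bar>g i\<bar>) * Br" if "l \<ge> 0" for l
      using that g(5) by (intro abs_suminf_mult_bounded_le g(3) Br)
  qed (use zero in auto)
  have [measurable]: "random_variable borel (y k)" "random_variable borel (u k)" for k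
    using A unfolding quasi_stationary_def by blast+
  \<comment> \<open>The noise is recovered from the signals by the ARX equation, hence is itself a stable filter of the innovations. At nonpositive times d is arbitrary, whereas d' is determined by the signals.\<close>
  define d' where "d' l \<omega> = y l \<omega> + (\<Sum>i=1..m. a i * y (l - int i) \<omega>) - (\<Sum>i=1..n. b i * u (l - int i) \<omega>)" for l \<omega>
  have d'_lin: "lin_filter d'"
    unfolding d'_def[abs_def]
    by (intro lin_filter_diff lin_filter_add lin_filter_sum lin_filter_scale lin_filter_delay y_lin u_lin)
  have [measurable]: "random_variable borel (d' l)" for l
    unfolding d'_def[abs_def] by measurable
  have d_eq: "AE \<omega> in M. d l \<omega> = d' l \<omega>" if "l \<ge> 1" for l
    using arx[OF that] by eventually_elim (simp add: d'_def)
  have d_meas: "random_variable borel (d l)" if "l \<ge> 1" for l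
    using assms(7) that unfolding gaussian_noise_def gaussian_rv_def by blast
  obtain R where R: "has_avg_expectation
            (\<lambda>k \<omega>. outer_product (regressor m idx y u k \<omega>) (regressor m idx y u k \<omega>)) R"
     "positive_definite R"
    using A unfolding persistently_exciting_def by blast
  have \<phi>_lin: "lin_filter (\<lambda>l \<omega>. regressor m idx y u l \<omega> $ c)" for c
    using lin_filter_uminus[OF lin_filter_delay[OF y_lin, of "idx c"]]
      lin_filter_delay[OF u_lin, of "idx c - m"]
    by (cases "idx c \<le> m") (simp_all add: regressor_def del: of_nat_diff)
  have \<phi>_meas: "random_variable borel (\<lambda>\<omega>. regressor m idx y u l \<omega> $ c)" for l c
    unfolding regressor_def by simp
  have uncorr: "expectation (\<lambda>\<omega>. regressor m idx y u l \<omega> $ c * d' l \<omega>) = 0" if l: "l \<ge> 1" for l c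
  proof -
    have "expectation (\<lambda>\<omega>. regressor m idx y u l \<omega> $ c * d' l \<omega>)
        = expectation (\<lambda>\<omega>. regressor m idx y u l \<omega> $ c * d l \<omega>)"
    proof (rule integral_cong_AE)
      show "AE \<omega> in M. regressor m idx y u l \<omega> $ c * d' l \<omega> = regressor m idx y u l \<omega> $ c * d l \<omega>"
        using d_eq[OF l] by eventually_elim simp
    qed (use \<phi>_meas d_meas[OF l] in measurable)
    also have "\<dots> = 0"
      using assms(8) l unfolding noise_uncorrelated_with_regressor_def by blast
    finally show ?thesis .
  qed
  have y_eq: "y l \<omega> = regressor m idx y u l \<omega> \<bullet> arx_parameter m a b idx + d' l \<omega>" for l \<omega>
    by (simp add: regressor_inner_parameter[OF assms(3)] d'_def)
  show ?thesis
    unfolding assms(10)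
    by (rule rls_moment_rate[OF \<phi>_lin \<phi>_meas d'_lin _ _ uncorr _ R assms(9)]) (auto simp: y_eq[symmetric])
qed

end
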